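(* Let $\mathcal{A}$ be an approximately Connes-biprojective dual Banach algebra and let $\varphi\in\Delta_{wk^*}(\mathcal{A})$ be such that $\ker\varphi=\overline{\mathcal{A}\ker\varphi}$. Then $\mathcal{A}$ is left $\varphi$-contractible.
   Context: A Banach algebra $\mathcal{A}$ is called a dual Banach algebra if there is a closed $\mathcal{A}$-submodule $\mathcal{A}_*$ of $\mathcal{A}^*$ such that $\mathcal{A}=(\mathcal{A}_* )^*$; the $wk^*$-topology on $\mathcal{A}$ is $\sigma(\mathcal{A},\mathcal{A}_* )$. For a Banach $\mathcal{A}$-bimodule $E$, the dual $E^*$ is a Banach $\mathcal{A}$-bimodule via $(a\cdot f)(x)=f(x\cdot a)$ and $(f\cdot a)(x)=f(a\cdot x)$. The projective tensor product $\mathcal{A}\hat{\otimes}\mathcal{A}$ is a Banach $\mathcal{A}$-bimodule via $a\cdot(b\otimes c)=ab\otimes c$, $(b\otimes c)\cdot a=b\otimes ca$, and $\pi_{\mathcal{A}}:\mathcal{A}\hat{\otimes}\mathcal{A}\to\mathcal{A}$ is the product morphism determined by $\pi_{\mathcal{A}}(a\otimes b)=ab$. For a Banach $\mathcal{A}$-bimodule $E$, $\sigma wc(E)$ denotes the set of all $x\in E$ such that the maps $\mathcal{A}\to E$, $a\mapsto a\cdot x$ and $a\mapsto x\cdot a$, are continuous from the $wk^*$-topology of $\mathcal{A}$ to the weak topology of $E$; it is a closed submodule of $E$. The notation $\sigma wc(\mathcal{A}\hat{\otimes}\mathcal{A})^*$ means $\sigma wc((\mathcal{A}\hat{\otimes}\mathcal{A})^*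 )$. Since $\sigma wc(\mathcal{A}_* )=\mathcal{A}_*$, the adjoint $\pi_{\mathcal{A}}^*$ maps $\mathcal{A}_*$ into $\sigma wc(\mathcal{A}\hat{\otimes}\mathcal{A})^*$, and $\pi_{\sigma wc}:(\sigma wc(\mathcal{A}\hat{\otimes}\mathcal{A})^* )^*\to\mathcal{A}=(\mathcal{A}_* )^*$ denotes the adjoint of $\pi_{\mathcal{A}}^*|_{\mathcal{A}_*}$; it is an $\mathcal{A}$-bimodule morphism. $\mathcal{A}$ is approximately Connes-biprojective if there exists a (not necessarily bounded) net $(\rho_\alpha)$ of continuous $\mathcal{A}$-bimodule morphisms from $\mathcal{A}$ into $(\sigma wc(\mathcal{A}\hat{\otimes}\mathcal{A})^* )^*$ such that $\pi_{\sigma wc}\circ\rho_\alpha(a)\to a$ in norm for every $a\in\mathcal{A}$. $\Delta_{wk^*}(\mathcal{A})$ denotes the set of all $wk^*$-continuous characters (nonzero multiplicative linear functionals) on $\mathcal{A}$. $\mathcal{A}\ker\varphi$ denotes the set of products $\{al: a\in\mathcal{A},\ l\in\ker\varphi\}$, and the bar denotes norm closure. For a character $\varphi$ on $\mathcal{A}$, $\mathcal{A}$ is left $\varphi$-contractible if there exists $m\in\mathcal{A}$ such that $am=\varphi(a)m$ for every $a\in\mathcal{A}$ and $\varphi(m)=1$. *)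

theory Defs
  imports "HOL-Analysis.Analysis"
begin

section \<open>Complex Banach spaces and Banach algebras\<close>

class scaleC =
  fixes scaleC :: "complex \<Rightarrow> 'a \<Rightarrow> 'a"  (infixr \<open>*\<^sub>C\<close> 75)

class complex_vector = real_vector + scaleC +
  assumes scaleC_add_right: "c *\<^sub>C (x + y) = c *\<^sub>C x + c *\<^sub>C y"
    and scaleC_add_left: "(c + d) *\<^sub>C x = c *\<^sub>C x + d *\<^sub>C x"
    and scaleC_scaleC: "c *\<^sub>C d *\<^sub>C x = (c * d) *\<^sub>C x"
    and scaleR_scaleC: "r *\<^sub>R x = complex_of_real r *\<^sub>C x"

class complex_normed_vector = complex_vector + real_normed_vector +
  assumes norm_scaleC: "norm (c *\<^sub>C x) = cmod c * norm x"

class complex_banach = complex_normed_vector + complete_space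

text \<open>Banach algebras are not assumed to have a unit.\<close>

class complex_banach_algebra = complex_banach + real_normed_algebra +
  assumes mult_scaleC_left: "(c *\<^sub>C x) * y = c *\<^sub>C (x * y)"
    and mult_scaleC_right: "x * (c *\<^sub>C y) = c *\<^sub>C (x * y)"

subclass (in complex_banach) banach ..

lemma scaleC_one [simp]: "1 *\<^sub>C (x :: 'a :: complex_vector) = x"
  using scaleR_scaleC[of 1 x] by simp

lemma scaleC_zero_left [simp]: "0 *\<^sub>C (x :: 'a :: complex_vector) = 0"
  using scaleR_scaleC[of 0 x] by simp

lemma scaleC_zero_right [simp]: "c *\<^sub>C (0 :: 'a :: complex_vector) = 0"
  using scaleC_add_right[of c 0 "0 :: 'a"] by simp

lemma scaleC_minus1: "(-1) *\<^sub>C (x :: 'a :: complex_vector) = - x"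
  using scaleR_scaleC[of "-1" x] by simp

lemma scaleC_minus_right: "c *\<^sub>C (- x :: 'a :: complex_vector) = - (c *\<^sub>C x)"
  using scaleC_add_right[of c x "- x"] by (simp add: eq_neg_iff_add_eq_0 add.commute)

lemma scaleC_diff_right: "c *\<^sub>C (x - y :: 'a :: complex_vector) = c *\<^sub>C x - c *\<^sub>C y"
  using scaleC_add_right[of c x "- y"] by (simp add: scaleC_minus_right)

instantiation complex :: complex_banach
begin
definition scaleC_complex :: "complex \<Rightarrow> complex \<Rightarrow> complex" where
  "scaleC_complex c x = c * x"
instance
  by standard (simp_all add: scaleC_complex_def algebra_simps norm_mult scaleR_conv_of_real)
end

definition clinear :: "('a :: complex_vector \<Rightarrow> 'b :: complex_vector) \<Rightarrow> bool" where
  "clinear T \<longleftrightarrow> (\<forall>x y. T (x + y) = T x + T y) \<and> (\<forall>c x. T (c *\<^sub>C x) = c *\<^sub>C T x)"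

definition bounded_clinear ::
    "('a :: complex_normed_vector \<Rightarrow> 'b :: complex_normed_vector) \<Rightarrow> bool" where
  "bounded_clinear T \<longleftrightarrow> clinear T \<and> (\<exists>K. \<forall>x. norm (T x) \<le> K * norm x)"

lemma bounded_clinear_imp_bounded_linear: "bounded_clinear T \<Longrightarrow> bounded_linear T"
proof -
  assume T: "bounded_clinear T"
  then obtain K where "\<And>x. norm (T x) \<le> K * norm x"
    unfolding bounded_clinear_def by blast
  with T show ?thesis
    unfolding bounded_clinear_def clinear_def
    by (intro bounded_linear_intro[of _ K]) (simp_all add: scaleR_scaleC mult.commute)
qed

lemma clinear_separation:
  fixes z :: "'a :: complex_vector"
  assumes "z \<noteq> 0"
  obtains h :: "'a \<Rightarrow> complex" where "clinear h" "h z \<noteq> 0"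
proof -
  interpret V: vector_space "scaleC :: complex \<Rightarrow> 'a \<Rightarrow> 'a"
    by standard (simp_all add: scaleC_add_right scaleC_add_left scaleC_scaleC)
  interpret W: vector_space "(*) :: complex \<Rightarrow> complex \<Rightarrow> complex"
    by standard (simp_all add: algebra_simps)
  interpret P: vector_space_pair "scaleC :: complex \<Rightarrow> 'a \<Rightarrow> 'a" "(*) :: complex \<Rightarrow> complex \<Rightarrow> complex"
    by standard
  have "V.independent {z}"
    using assms by simp
  from P.linear_independent_extend[OF this, of "\<lambda>_. 1"]
  obtain g where g: "Vector_Spaces.linear scaleC (*) g" "g z = 1" by auto
  interpret g: Vector_Spaces.linear scaleC "(*)" g by fact
  have "clinear g"
    by (simp add: clinear_def scaleC_complex_def g.add g.scale)
  with g(2) show ?thesis using that by force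
qed


section \<open>The Banach space dual\<close>

typedef (overloaded) 'a cdual =
  "{f :: 'a :: complex_normed_vector \<Rightarrow>\<^sub>L complex.
      \<forall>c x. blinfun_apply f (c *\<^sub>C x) = c * blinfun_apply f x}"
  by (rule exI[of _ 0]) simp

setup_lifting type_definition_cdual

lift_definition dual_apply :: "'a :: complex_normed_vector cdual \<Rightarrow> 'a \<Rightarrow> complex"
  is blinfun_apply .

lemma cdual_eqI: "(\<And>x. dual_apply f x = dual_apply g x) \<Longrightarrow> f = g"
  by transfer (auto intro: blinfun_eqI)

instantiation cdual :: (complex_normed_vector) complex_vector
begin

lift_definition zero_cdual :: "'a cdual" is 0 by simp
lift_definition plus_cdual :: "'a cdual \<Rightarrow> 'a cdual \<Rightarrow> 'a cdual" is "(+)"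
  by (simp add: blinfun.add_left algebra_simps)
lift_definition minus_cdual :: "'a cdual \<Rightarrow> 'a cdual \<Rightarrow> 'a cdual" is "(-)"
  by (simp add: blinfun.diff_left algebra_simps)
lift_definition uminus_cdual :: "'a cdual \<Rightarrow> 'a cdual" is "uminus"
  by (simp add: blinfun.minus_left)
lift_definition scaleR_cdual :: "real \<Rightarrow> 'a cdual \<Rightarrow> 'a cdual" is "scaleR"
  by (simp add: blinfun.scaleR_left)
lift_definition scaleC_cdual :: "complex \<Rightarrow> 'a cdual \<Rightarrow> 'a cdual"
  is "\<lambda>c f. blinfun_mult_right c o\<^sub>L f"
  by simp

instance
proof
  fix f g h :: "'a cdual" and a b :: real and c d :: complex
  show "f + g + h = f + (g + h)" by transfer simp
  show "f + g = g + f" by transfer simp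
  show "0 + f = f" by transfer simp
  show "- f + f = 0" by transfer simp
  show "f - g = f + - g" by transfer simp
  show "a *\<^sub>R (f + g) = a *\<^sub>R f + a *\<^sub>R g" by transfer (simp add: algebra_simps)
  show "(a + b) *\<^sub>R f = a *\<^sub>R f + b *\<^sub>R f" by transfer (simp add: algebra_simps)
  show "a *\<^sub>R b *\<^sub>R f = (a * b) *\<^sub>R f" by transfer simp
  show "1 *\<^sub>R f = f" by transfer simp
  show "c *\<^sub>C (f + g) = c *\<^sub>C f + c *\<^sub>C g"
    by transfer (auto intro!: blinfun_eqI simp: blinfun.add_left algebra_simps)
  show "(c + d) *\<^sub>C f = c *\<^sub>C f + d *\<^sub>C f"
    by transfer (auto intro!: blinfun_eqI simp: blinfun.add_left algebra_simps)
  show "c *\<^sub>C d *\<^sub>C f = (c * d) *\<^sub>C f"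
    by transfer (auto intro!: blinfun_eqI)
  show "a *\<^sub>R f = complex_of_real a *\<^sub>C f"
    by transfer (auto intro!: blinfun_eqI simp: blinfun.scaleR_left scaleR_conv_of_real)
qed

end

instantiation cdual :: (complex_normed_vector) complex_normed_vector
begin

lift_definition norm_cdual :: "'a cdual \<Rightarrow> real" is norm .
definition sgn_cdual :: "'a cdual \<Rightarrow> 'a cdual" where
  "sgn_cdual f = f /\<^sub>R norm f"
definition dist_cdual :: "'a cdual \<Rightarrow> 'a cdual \<Rightarrow> real" where
  "dist_cdual f g = norm (f - g)"
definition uniformity_cdual :: "('a cdual \<times> 'a cdual) filter" where
  "uniformity_cdual = (INF e\<in>{0<..}. principal {(f, g). dist f g < e})"
definition open_cdual :: "'a cdual set \<Rightarrow> bool" where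
  "open_cdual U \<longleftrightarrow> (\<forall>x\<in>U. \<forall>\<^sub>F (x', y) in uniformity. x' = x \<longrightarrow> y \<in> U)"

instance
proof
  fix f g h :: "'a cdual" and a b :: real and c d :: complex
  show "sgn f = f /\<^sub>R norm f" by (rule sgn_cdual_def)
  show "dist f g = norm (f - g)" by (rule dist_cdual_def)
  show "uniformity = (INF e\<in>{0<..}. principal {(x, y :: 'a cdual). dist x y < e})"
    by (rule uniformity_cdual_def)
  show "open U \<longleftrightarrow> (\<forall>x\<in>U. \<forall>\<^sub>F (x', y) in uniformity. x' = x \<longrightarrow> y \<in> U)" for U :: "'a cdual set"
    by (rule open_cdual_def)
  show "(norm f = 0) = (f = 0)" by transfer simp
  show "norm (f + g) \<le> norm f + norm g" by transfer (rule norm_triangle_ineq)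
  show "norm (a *\<^sub>R f) = \<bar>a\<bar> * norm f" by transfer simp
  show "norm (c *\<^sub>C f) = cmod c * norm f"
  proof (transfer fixing: c)
    fix f :: "'a \<Rightarrow>\<^sub>L complex"
    have le: "norm (blinfun_mult_right k o\<^sub>L f) \<le> cmod k * norm f" for k and f :: "'a \<Rightarrow>\<^sub>L complex"
      by (rule norm_blinfun_bound)
        (auto simp: norm_mult mult.assoc intro!: mult_left_mono norm_blinfun)
    show "norm (blinfun_mult_right c o\<^sub>L f) = cmod c * norm f"
    proof (cases "c = 0")
      case True
      have "blinfun_mult_right c o\<^sub>L f = 0"
        by (rule blinfun_eqI) (simp add: True)
      with True show ?thesis by simp
    next
      case False
      have eq: "blinfun_mult_right (inverse c) o\<^sub>L (blinfun_mult_right c o\<^sub>L f) = f"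
        by (rule blinfun_eqI) (simp add: False)
      have "norm f \<le> cmod (inverse c) * norm (blinfun_mult_right c o\<^sub>L f)"
        using le[of "inverse c" "blinfun_mult_right c o\<^sub>L f"] by (simp only: eq)
      with False have "cmod c * norm f \<le> norm (blinfun_mult_right c o\<^sub>L f)"
        by (simp add: norm_inverse inverse_eq_divide[of "cmod c"] pos_le_divide_eq mult.commute)
      with le[of c f] show ?thesis by simp
    qed
  qed
qed

end

instance cdual :: (complex_normed_vector) complex_banach
proof
  fix X :: "nat \<Rightarrow> 'a cdual"
  assume X: "Cauchy X"
  define Y where "Y n = Rep_cdual (X n)" for n
  have "dist (Y m) (Y n) = dist (X m) (X n)" for m n
    by (simp add: Y_def dist_norm norm_cdual.rep_eq minus_cdual.rep_eq)
  with X have "Cauchy Y" by (simp add: Cauchy_def)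
  then obtain g where g: "Y \<longlonglongrightarrow> g"
    using Cauchy_convergent convergent_def by blast
  have lim: "(\<lambda>n. blinfun_apply (Y n) x) \<longlonglongrightarrow> blinfun_apply g x" for x
    using g by (intro tendsto_intros)
  have "blinfun_apply g (c *\<^sub>C x) = c * blinfun_apply g x" for c x
  proof (rule LIMSEQ_unique[OF lim])
    have "blinfun_apply (Y n) (c *\<^sub>C x) = c * blinfun_apply (Y n) x" for n
      using Rep_cdual[of "X n"] by (simp add: Y_def)
    then show "(\<lambda>n. blinfun_apply (Y n) (c *\<^sub>C x)) \<longlonglongrightarrow> c * blinfun_apply g x"
      by (simp add: tendsto_mult_left lim)
  qed
  then have Rg: "Rep_cdual (Abs_cdual g) = g"
    by (simp add: Abs_cdual_inverse)
  have "dist (X n) (Abs_cdual g) = dist (Y n) g" for n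
    by (simp add: Y_def dist_norm norm_cdual.rep_eq minus_cdual.rep_eq Rg)
  moreover have "(\<lambda>n. dist (Y n) g) \<longlonglongrightarrow> 0"
    using g tendsto_dist_iff by blast
  ultimately have "X \<longlonglongrightarrow> Abs_cdual g"
    by (subst tendsto_dist_iff) simp
  then show "convergent X"
    unfolding convergent_def by blast
qed

lemma dual_apply_add: "dual_apply f (x + y) = dual_apply f x + dual_apply f y"
  by transfer (simp add: blinfun.add_right)

lemma dual_apply_diff: "dual_apply f (x - y) = dual_apply f x - dual_apply f y"
  by transfer (simp add: blinfun.diff_right)

lemma dual_apply_scaleC: "dual_apply f (c *\<^sub>C x) = c * dual_apply f x"
  by transfer simp

lemma norm_dual_apply: "cmod (dual_apply f x) \<le> norm f * norm x"
  by transfer (rule norm_blinfun)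

lemma dual_apply_plus: "dual_apply (f + g) x = dual_apply f x + dual_apply g x"
  by transfer (simp add: blinfun.add_left)

lemma dual_apply_scale: "dual_apply (c *\<^sub>C f) x = c * dual_apply f x"
  by transfer simp

lemma norm_cdual_bound:
  assumes "0 \<le> K" "\<And>x. cmod (dual_apply f x) \<le> K * norm x"
  shows "norm f \<le> K"
  using assms by (transfer fixing: K) (rule norm_blinfun_bound)

definition cdual_of :: "('a :: complex_normed_vector \<Rightarrow> complex) \<Rightarrow> 'a cdual" where
  "cdual_of f = Abs_cdual (Blinfun f)"

lemma dual_apply_cdual_of [simp]:
  assumes "bounded_clinear f"
  shows "dual_apply (cdual_of f) = f"
proof -
  have "bounded_linear f"
    using assms by (rule bounded_clinear_imp_bounded_linear)
  moreover have "f (c *\<^sub>C x) = c * f x" for c x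
    using assms by (simp add: bounded_clinear_def clinear_def scaleC_complex_def)
  ultimately show ?thesis
    by (simp add: dual_apply_def cdual_of_def Abs_cdual_inverse bounded_linear_Blinfun_apply)
qed

lemma bounded_clinear_dual_apply: "bounded_clinear (dual_apply f)"
  unfolding bounded_clinear_def clinear_def scaleC_complex_def
  by (auto simp: dual_apply_add dual_apply_scaleC intro: norm_dual_apply)


section \<open>The projective tensor product\<close>

definition cbilinear :: "('a :: complex_vector \<Rightarrow> 'a \<Rightarrow> complex) \<Rightarrow> bool" where
  "cbilinear B \<longleftrightarrow> (\<forall>y. clinear (\<lambda>x. B x y)) \<and> (\<forall>x. clinear (B x))"

text \<open>
  The algebraic tensor product is realised as the space of functionals on bilinear forms that is
  spanned by the evaluations \<open>B \<mapsto> B x y\<close>; the latter are the elementary tensors. A list of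
  pairs stands for the sum of the corresponding elementary tensors.
\<close>

definition tensor_sum ::
    "('a :: complex_vector \<times> 'a) list \<Rightarrow> ('a \<Rightarrow> 'a \<Rightarrow> complex) \<Rightarrow> complex" where
  "tensor_sum xs = (\<lambda>B. if cbilinear B then \<Sum>(x, y)\<leftarrow>xs. B x y else 0)"

typedef (overloaded) 'a atensor =
  "range (tensor_sum :: ('a :: complex_vector \<times> 'a) list \<Rightarrow> _)"
  by blast

setup_lifting type_definition_atensor

lift_definition atensor_of :: "('a :: complex_vector \<times> 'a) list \<Rightarrow> 'a atensor" is tensor_sum
  by blast

lemma atensor_exhaust: obtains xs where "t = atensor_of xs"
  by transfer auto

lemma tensor_sum_append: "tensor_sum (xs @ ys) B = tensor_sum xs B + tensor_sum ys B"
  by (simp add: tensor_sum_def)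

lemma tensor_sum_scaleC: "tensor_sum (map (\<lambda>(x, y). (c *\<^sub>C x, y)) xs) B = c * tensor_sum xs B"
  by (induction xs)
    (auto simp: tensor_sum_def cbilinear_def clinear_def scaleC_complex_def algebra_simps)

lemma tensor_sum_minus:
  "tensor_sum (map (\<lambda>(x, y). (- x, y)) xs) B = - tensor_sum xs (B :: 'a :: complex_vector \<Rightarrow> _)"
  using tensor_sum_scaleC[of "-1" xs B] by (simp add: scaleC_minus1)

instantiation atensor :: (complex_vector) complex_vector
begin

lift_definition zero_atensor :: "'a atensor" is "\<lambda>_. 0"
  by (rule image_eqI[of _ _ "[]"]) (auto simp: tensor_sum_def)
lift_definition plus_atensor :: "'a atensor \<Rightarrow> 'a atensor \<Rightarrow> 'a atensor"
  is "\<lambda>s t B. s B + t B"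
proof -
  fix s t :: "('a \<Rightarrow> 'a \<Rightarrow> complex) \<Rightarrow> complex"
  assume "s \<in> range tensor_sum" "t \<in> range tensor_sum"
  then obtain xs ys where "s = tensor_sum xs" "t = tensor_sum ys" by blast
  then have "(\<lambda>B. s B + t B) = tensor_sum (xs @ ys)"
    by (simp add: fun_eq_iff tensor_sum_append)
  then show "(\<lambda>B. s B + t B) \<in> range tensor_sum" by (rule range_eqI)
qed
lift_definition uminus_atensor :: "'a atensor \<Rightarrow> 'a atensor" is "\<lambda>t B. - t B"
proof -
  fix t :: "('a \<Rightarrow> 'a \<Rightarrow> complex) \<Rightarrow> complex"
  assume "t \<in> range tensor_sum"
  then obtain xs where "t = tensor_sum xs" by blast
  then have "(\<lambda>B. - t B) = tensor_sum (map (\<lambda>(x, y). (- x, y)) xs)"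
    by (simp add: fun_eq_iff tensor_sum_minus)
  then show "(\<lambda>B. - t B) \<in> range tensor_sum" by (rule range_eqI)
qed
definition minus_atensor :: "'a atensor \<Rightarrow> 'a atensor \<Rightarrow> 'a atensor" where
  "minus_atensor s t = s + - t"
lift_definition scaleC_atensor :: "complex \<Rightarrow> 'a atensor \<Rightarrow> 'a atensor" is "\<lambda>c t B. c * t B"
proof -
  fix c :: complex and t :: "('a \<Rightarrow> 'a \<Rightarrow> complex) \<Rightarrow> complex"
  assume "t \<in> range tensor_sum"
  then obtain xs where "t = tensor_sum xs" by blast
  then have "(\<lambda>B. c * t B) = tensor_sum (map (\<lambda>(x, y). (c *\<^sub>C x, y)) xs)"
    by (simp add: fun_eq_iff tensor_sum_scaleC)
  then show "(\<lambda>B. c * t B) \<in> range tensor_sum" by (rule range_eqI)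
qed
definition scaleR_atensor :: "real \<Rightarrow> 'a atensor \<Rightarrow> 'a atensor" where
  "scaleR_atensor r t = complex_of_real r *\<^sub>C t"

instance
proof
  fix s t u :: "'a atensor" and a b :: real and c d :: complex
  show "s + t + u = s + (t + u)" by transfer (simp add: algebra_simps)
  show "s + t = t + s" by transfer (simp add: algebra_simps)
  show "0 + s = s" by transfer simp
  show "- s + s = 0" by transfer simp
  show "s - t = s + - t" by (rule minus_atensor_def)
  show "c *\<^sub>C (s + t) = c *\<^sub>C s + c *\<^sub>C t" by transfer (simp add: algebra_simps)
  show "(c + d) *\<^sub>C s = c *\<^sub>C s + d *\<^sub>C s" by transfer (simp add: algebra_simps)
  show "c *\<^sub>C d *\<^sub>C s = (c * d) *\<^sub>C s" by transfer (simp add: algebra_simps)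
  show "a *\<^sub>R (s + t) = a *\<^sub>R s + a *\<^sub>R t"
    unfolding scaleR_atensor_def by transfer (simp add: algebra_simps)
  show "(a + b) *\<^sub>R s = a *\<^sub>R s + b *\<^sub>R s"
    unfolding scaleR_atensor_def by transfer (simp add: algebra_simps)
  show "a *\<^sub>R b *\<^sub>R s = (a * b) *\<^sub>R s"
    unfolding scaleR_atensor_def by transfer (simp add: algebra_simps)
  show "1 *\<^sub>R s = s" unfolding scaleR_atensor_def by transfer simp
  show "a *\<^sub>R s = complex_of_real a *\<^sub>C s" by (rule scaleR_atensor_def)
qed

end

lemma atensor_of_append: "atensor_of (xs @ ys) = atensor_of xs + atensor_of ys"
  by transfer (simp add: tensor_sum_append fun_eq_iff)

lemma atensor_of_scaleC: "atensor_of (map (\<lambda>(x, y). (c *\<^sub>C x, y)) xs) = c *\<^sub>C atensor_of xs"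
  by transfer (simp add: tensor_sum_scaleC fun_eq_iff)

definition list_cost :: "('a :: real_normed_vector \<times> 'a) list \<Rightarrow> real" where
  "list_cost xs = (\<Sum>(x, y)\<leftarrow>xs. norm x * norm y)"

definition proj_norm :: "'a :: complex_normed_vector atensor \<Rightarrow> real" where
  "proj_norm t = (INF xs\<in>{xs. atensor_of xs = t}. list_cost xs)"

lemma list_cost_nonneg: "0 \<le> list_cost xs"
  unfolding list_cost_def by (rule sum_list_nonneg) auto

lemma proj_norm_le: "proj_norm (atensor_of xs) \<le> list_cost xs"
  unfolding proj_norm_def
  by (rule cINF_lower) (auto intro!: bdd_belowI[of _ 0] simp: list_cost_nonneg)

lemma proj_norm_greatest:
  assumes "\<And>xs. atensor_of xs = t \<Longrightarrow> k \<le> list_cost xs"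
  shows "k \<le> proj_norm t"
proof -
  obtain xs where "t = atensor_of xs" by (rule atensor_exhaust)
  then show ?thesis
    unfolding proj_norm_def by (intro cINF_greatest) (auto intro: assms)
qed

lemma proj_norm_nonneg: "0 \<le> proj_norm t"
  by (rule proj_norm_greatest) (rule list_cost_nonneg)

lemma proj_norm_zero: "proj_norm (0 :: 'a :: complex_normed_vector atensor) = 0"
proof -
  have "atensor_of [] = (0 :: 'a atensor)"
    by transfer (auto simp: tensor_sum_def)
  with proj_norm_le[of "[] :: ('a \<times> 'a) list"] show ?thesis
    using proj_norm_nonneg[of "0 :: 'a atensor"] by (simp add: list_cost_def)
qed

lemma proj_norm_triangle: "proj_norm (s + t) \<le> proj_norm s + proj_norm t"
proof -
  have "proj_norm (s + t) - list_cost ys \<le> proj_norm s" if ys: "atensor_of ys = t" for ys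
  proof (rule proj_norm_greatest)
    fix xs assume "atensor_of xs = s"
    then show "proj_norm (s + t) - list_cost ys \<le> list_cost xs"
      using proj_norm_le[of "xs @ ys"] ys by (simp add: atensor_of_append list_cost_def)
  qed
  then have "proj_norm (s + t) - proj_norm s \<le> proj_norm t"
    by (intro proj_norm_greatest) (simp add: algebra_simps)
  then show ?thesis by simp
qed

lemma proj_norm_scaleC: "proj_norm (c *\<^sub>C t) = cmod c * proj_norm t"
proof -
  have le: "proj_norm (c *\<^sub>C t) \<le> cmod c * proj_norm t" if "c \<noteq> 0" for c and t :: "'a atensor"
  proof -
    have "proj_norm (c *\<^sub>C t) / cmod c \<le> proj_norm t"
    proof (rule proj_norm_greatest)
      fix xs assume xs: "atensor_of xs = t"
      have "list_cost (map (\<lambda>(x, y). (c *\<^sub>C x, y)) xs) = cmod c * list_cost xs"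
        by (induction xs) (auto simp: list_cost_def norm_scaleC algebra_simps)
      with proj_norm_le[of "map (\<lambda>(x, y). (c *\<^sub>C x, y)) xs"] xs that
      show "proj_norm (c *\<^sub>C t) / cmod c \<le> list_cost xs"
        by (simp add: atensor_of_scaleC field_simps)
    qed
    with that show ?thesis by (simp add: field_simps)
  qed
  show ?thesis
  proof (cases "c = 0")
    case True
    then show ?thesis by (simp add: proj_norm_zero)
  next
    case False
    with le[of "inverse c" "c *\<^sub>C t"] have "cmod c * proj_norm t \<le> proj_norm (c *\<^sub>C t)"
      by (simp add: scaleC_scaleC norm_inverse inverse_eq_divide[of "cmod c"] pos_le_divide_eq mult.commute)
    with le[OF False, of t] show ?thesis by simp
  qed
qed

lemma proj_norm_minus: "proj_norm (- t) = proj_norm t"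
  using proj_norm_scaleC[of "-1" t] by (simp add: scaleC_minus1)

lemma proj_norm_minus_commute: "proj_norm (s - t) = proj_norm (t - s)"
  using proj_norm_minus[of "s - t"] by simp

lemma proj_norm_diff_triangle: "\<bar>proj_norm s - proj_norm t\<bar> \<le> proj_norm (s - t)"
  using proj_norm_triangle[of "s - t" t] proj_norm_triangle[of "t - s" s]
  by (simp add: proj_norm_minus_commute[of s t])

text \<open>The completion of the algebraic tensor product in the projective norm.\<close>

definition proj_Cauchy :: "(nat \<Rightarrow> 'a :: complex_normed_vector atensor) \<Rightarrow> bool" where
  "proj_Cauchy X \<longleftrightarrow> (\<forall>e>0. \<exists>N. \<forall>m\<ge>N. \<forall>n\<ge>N. proj_norm (X m - X n) < e)"

definition proj_equiv :: "(nat \<Rightarrow> 'a :: complex_normed_vector atensor) \<Rightarrow> (nat \<Rightarrow> 'a atensor) \<Rightarrow> bool"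
  where "proj_equiv X Y \<longleftrightarrow>
    proj_Cauchy X \<and> proj_Cauchy Y \<and> (\<lambda>n. proj_norm (X n - Y n)) \<longlonglongrightarrow> 0"

lemma proj_norm_squeeze:
  assumes "g \<longlonglongrightarrow> 0" "\<And>n. proj_norm (X n) \<le> g n"
  shows "(\<lambda>n. proj_norm (X n)) \<longlonglongrightarrow> 0"
  by (rule Lim_null_comparison[OF _ assms(1)]) (simp add: proj_norm_nonneg assms(2))

lemma proj_Cauchy_const: "proj_Cauchy (\<lambda>_. t)"
  by (simp add: proj_Cauchy_def proj_norm_zero)

lemma proj_Cauchy_add:
  assumes "proj_Cauchy X" "proj_Cauchy Y"
  shows "proj_Cauchy (\<lambda>n. X n + Y n)"
  unfolding proj_Cauchy_def
proof (intro allI impI)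
  fix e :: real assume "e > 0"
  then have "e / 2 > 0" by simp
  with assms obtain M N where
    M: "\<And>m n. m \<ge> M \<Longrightarrow> n \<ge> M \<Longrightarrow> proj_norm (X m - X n) < e / 2" and
    N: "\<And>m n. m \<ge> N \<Longrightarrow> n \<ge> N \<Longrightarrow> proj_norm (Y m - Y n) < e / 2"
    unfolding proj_Cauchy_def by metis
  have "proj_norm (X m + Y m - (X n + Y n)) < e" if "m \<ge> max M N" "n \<ge> max M N" for m n
    using proj_norm_triangle[of "X m - X n" "Y m - Y n"] M[of m n] N[of m n] that
    by (simp add: algebra_simps)
  then show "\<exists>N. \<forall>m\<ge>N. \<forall>n\<ge>N. proj_norm (X m + Y m - (X n + Y n)) < e" by blast
qed

lemma proj_Cauchy_image:
  assumes X: "proj_Cauchy X"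
    and T: "\<And>s t. T (s - t) = T s - T t" "\<And>t. proj_norm (T t) \<le> K * proj_norm t"
  shows "proj_Cauchy (\<lambda>n. T (X n))"
  unfolding proj_Cauchy_def
proof (intro allI impI)
  fix e :: real assume "e > 0"
  then have "e / (\<bar>K\<bar> + 1) > 0" by simp
  with X obtain N where N: "\<And>m n. m \<ge> N \<Longrightarrow> n \<ge> N \<Longrightarrow> proj_norm (X m - X n) < e / (\<bar>K\<bar> + 1)"
    unfolding proj_Cauchy_def by metis
  have "proj_norm (T (X m) - T (X n)) < e" if "m \<ge> N" "n \<ge> N" for m n
  proof -
    have "proj_norm (T (X m) - T (X n)) \<le> K * proj_norm (X m - X n)"
      using T(2)[of "X m - X n"] by (simp add: T(1))
    also have "\<dots> \<le> (\<bar>K\<bar> + 1) * proj_norm (X m - X n)"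
      by (intro mult_right_mono proj_norm_nonneg) simp
    also have "\<dots> < e"
      using N[OF that] by (simp add: field_simps)
    finally show ?thesis .
  qed
  then show "\<exists>N. \<forall>m\<ge>N. \<forall>n\<ge>N. proj_norm (T (X m) - T (X n)) < e" by blast
qed

lemma proj_equiv_image:
  assumes XY: "proj_equiv X Y"
    and T: "\<And>s t. T (s - t) = T s - T t" "\<And>t. proj_norm (T t) \<le> K * proj_norm t"
  shows "proj_equiv (\<lambda>n. T (X n)) (\<lambda>n. T (Y n))"
proof -
  have "(\<lambda>n. proj_norm (T (X n) - T (Y n))) \<longlonglongrightarrow> 0"
  proof (rule proj_norm_squeeze)
    show "(\<lambda>n. K * proj_norm (X n - Y n)) \<longlonglongrightarrow> 0"
      using XY unfolding proj_equiv_def by (intro tendsto_mult_right_zero) auto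
    show "proj_norm (T (X n) - T (Y n)) \<le> K * proj_norm (X n - Y n)" for n
      using T(2)[of "X n - Y n"] by (simp add: T(1))
  qed
  with XY T show ?thesis
    unfolding proj_equiv_def by (blast intro: proj_Cauchy_image)
qed

lemma proj_equiv_add:
  assumes "proj_equiv X X'" "proj_equiv Y Y'"
  shows "proj_equiv (\<lambda>n. X n + Y n) (\<lambda>n. X' n + Y' n)"
proof -
  have "(\<lambda>n. proj_norm (X n + Y n - (X' n + Y' n))) \<longlonglongrightarrow> 0"
  proof (rule proj_norm_squeeze)
    show "(\<lambda>n. proj_norm (X n - X' n) + proj_norm (Y n - Y' n)) \<longlonglongrightarrow> 0"
      using assms unfolding proj_equiv_def by (intro tendsto_add_zero) auto
    show "proj_norm (X n + Y n - (X' n + Y' n)) \<le> proj_norm (X n - X' n) + proj_norm (Y n - Y' n)" for n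
      using proj_norm_triangle[of "X n - X' n" "Y n - Y' n"] by (simp add: algebra_simps)
  qed
  with assms show ?thesis
    unfolding proj_equiv_def by (blast intro: proj_Cauchy_add)
qed

lemma proj_equiv_scaleC:
  assumes "proj_equiv X Y"
  shows "proj_equiv (\<lambda>n. c *\<^sub>C X n) (\<lambda>n. c *\<^sub>C Y n)"
  by (rule proj_equiv_image[OF assms, of _ "cmod c"])
    (simp_all add: scaleC_diff_right proj_norm_scaleC)

lemma convergent_proj_norm: "proj_Cauchy X \<Longrightarrow> convergent (\<lambda>n. proj_norm (X n))"
  unfolding Cauchy_convergent_iff[symmetric] Cauchy_def proj_Cauchy_def dist_real_def
  by (meson order.strict_trans1 proj_norm_diff_triangle)

lemma tendsto_lim_proj_norm: "proj_Cauchy X \<Longrightarrow> (\<lambda>n. proj_norm (X n)) \<longlonglongrightarrow> lim (\<lambda>n. proj_norm (X n))"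
  by (rule convergent_LIMSEQ_iff[THEN iffD1, OF convergent_proj_norm])

lemma proj_norm_lim_eq:
  assumes "proj_equiv X Y"
  shows "lim (\<lambda>n. proj_norm (X n)) = lim (\<lambda>n. proj_norm (Y n))"
proof (rule limI)
  have Y: "(\<lambda>n. proj_norm (Y n)) \<longlonglongrightarrow> lim (\<lambda>n. proj_norm (Y n))"
    using assms unfolding proj_equiv_def by (intro tendsto_lim_proj_norm) simp
  have "(\<lambda>n. proj_norm (X n) - proj_norm (Y n)) \<longlonglongrightarrow> 0"
  proof (rule Lim_null_comparison)
    show "(\<lambda>n. proj_norm (X n - Y n)) \<longlonglongrightarrow> 0"
      using assms by (simp add: proj_equiv_def)
    show "\<forall>\<^sub>F n in sequentially. norm (proj_norm (X n) - proj_norm (Y n)) \<le> proj_norm (X n - Y n)"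
      by (simp add: proj_norm_diff_triangle)
  qed
  from tendsto_add[OF this Y] show "(\<lambda>n. proj_norm (X n)) \<longlonglongrightarrow> lim (\<lambda>n. proj_norm (Y n))" by simp
qed

quotient_type (overloaded) 'a ptensor =
  "nat \<Rightarrow> 'a :: complex_normed_vector atensor" / partial: proj_equiv
proof (rule part_equivpI)
  show "\<exists>X :: nat \<Rightarrow> 'a atensor. proj_equiv X X"
    by (rule exI[of _ "\<lambda>_. 0"]) (simp add: proj_equiv_def proj_Cauchy_const proj_norm_zero)
  show "symp (proj_equiv :: (nat \<Rightarrow> 'a atensor) \<Rightarrow> _)"
    by (rule sympI) (simp add: proj_equiv_def proj_norm_minus_commute)
  show "transp (proj_equiv :: (nat \<Rightarrow> 'a atensor) \<Rightarrow> _)"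
  proof (rule transpI)
    fix X Y Z :: "nat \<Rightarrow> 'a atensor"
    assume *: "proj_equiv X Y" "proj_equiv Y Z"
    have "(\<lambda>n. proj_norm (X n - Z n)) \<longlonglongrightarrow> 0"
    proof (rule proj_norm_squeeze)
      show "(\<lambda>n. proj_norm (X n - Y n) + proj_norm (Y n - Z n)) \<longlonglongrightarrow> 0"
        using * unfolding proj_equiv_def by (intro tendsto_add_zero) auto
      show "proj_norm (X n - Z n) \<le> proj_norm (X n - Y n) + proj_norm (Y n - Z n)" for n
        using proj_norm_triangle[of "X n - Y n" "Y n - Z n"] by simp
    qed
    with * show "proj_equiv X Z" by (simp add: proj_equiv_def)
  qed
qed

lemma proj_equiv_refl: "proj_Cauchy X \<Longrightarrow> proj_equiv X X"
  by (simp add: proj_equiv_def proj_norm_zero)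

instantiation ptensor :: (complex_normed_vector) complex_vector
begin

lift_definition zero_ptensor :: "'a ptensor" is "\<lambda>_. 0"
  by (simp add: proj_equiv_refl proj_Cauchy_const)
lift_definition plus_ptensor :: "'a ptensor \<Rightarrow> 'a ptensor \<Rightarrow> 'a ptensor" is "\<lambda>X Y n. X n + Y n"
  by (rule proj_equiv_add)
lift_definition scaleC_ptensor :: "complex \<Rightarrow> 'a ptensor \<Rightarrow> 'a ptensor" is "\<lambda>c X n. c *\<^sub>C X n"
  by (rule proj_equiv_scaleC)
definition uminus_ptensor :: "'a ptensor \<Rightarrow> 'a ptensor" where
  "uminus_ptensor u = (-1) *\<^sub>C u"
definition minus_ptensor :: "'a ptensor \<Rightarrow> 'a ptensor \<Rightarrow> 'a ptensor" where
  "minus_ptensor u v = u + - v"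
definition scaleR_ptensor :: "real \<Rightarrow> 'a ptensor \<Rightarrow> 'a ptensor" where
  "scaleR_ptensor r u = complex_of_real r *\<^sub>C u"

instance
proof
  fix u v w :: "'a ptensor" and a b :: real and c d :: complex
  note [simp] = proj_equiv_add proj_equiv_scaleC
  show "u + v + w = u + (v + w)" by transfer (simp add: add.assoc)
  show "u + v = v + u" by transfer (simp add: add.commute)
  show "0 + u = u" by transfer simp
  show "- u + u = 0" unfolding uminus_ptensor_def
    by transfer (simp add: scaleC_minus1 proj_equiv_refl proj_Cauchy_const)
  show "u - v = u + - v" by (rule minus_ptensor_def)
  have 1: "k *\<^sub>C (u + v) = k *\<^sub>C u + k *\<^sub>C v" for k :: complex
    by transfer (simp add: scaleC_add_right)
  have 2: "(k + l) *\<^sub>C u = k *\<^sub>C u + l *\<^sub>C u" for k l :: complex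
    by transfer (simp add: scaleC_add_left)
  have 3: "k *\<^sub>C l *\<^sub>C u = (k * l) *\<^sub>C u" for k l :: complex
    by transfer (simp add: scaleC_scaleC)
  show "c *\<^sub>C (u + v) = c *\<^sub>C u + c *\<^sub>C v" by (rule 1)
  show "(c + d) *\<^sub>C u = c *\<^sub>C u + d *\<^sub>C u" by (rule 2)
  show "c *\<^sub>C d *\<^sub>C u = (c * d) *\<^sub>C u" by (rule 3)
  show "a *\<^sub>R (u + v) = a *\<^sub>R u + a *\<^sub>R v" by (simp add: scaleR_ptensor_def 1)
  show "(a + b) *\<^sub>R u = a *\<^sub>R u + b *\<^sub>R u" by (simp add: scaleR_ptensor_def 2)
  show "a *\<^sub>R b *\<^sub>R u = (a * b) *\<^sub>R u" by (simp add: scaleR_ptensor_def 3)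
  show "1 *\<^sub>R u = u" unfolding scaleR_ptensor_def by transfer simp
  show "a *\<^sub>R u = complex_of_real a *\<^sub>C u" by (rule scaleR_ptensor_def)
qed

end

instantiation ptensor :: (complex_normed_vector) complex_normed_vector
begin

lift_definition norm_ptensor :: "'a ptensor \<Rightarrow> real" is "\<lambda>X. lim (\<lambda>n. proj_norm (X n))"
  by (rule proj_norm_lim_eq)
definition sgn_ptensor :: "'a ptensor \<Rightarrow> 'a ptensor" where
  "sgn_ptensor u = u /\<^sub>R norm u"
definition dist_ptensor :: "'a ptensor \<Rightarrow> 'a ptensor \<Rightarrow> real" where
  "dist_ptensor u v = norm (u - v)"
definition uniformity_ptensor :: "('a ptensor \<times> 'a ptensor) filter" where
  "uniformity_ptensor = (INF e\<in>{0<..}. principal {(u, v). dist u v < e})"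
definition open_ptensor :: "'a ptensor set \<Rightarrow> bool" where
  "open_ptensor U \<longleftrightarrow> (\<forall>x\<in>U. \<forall>\<^sub>F (x', y) in uniformity. x' = x \<longrightarrow> y \<in> U)"

instance
proof
  fix u v :: "'a ptensor" and a :: real and c :: complex
  show "sgn u = u /\<^sub>R norm u" by (rule sgn_ptensor_def)
  show "dist u v = norm (u - v)" by (rule dist_ptensor_def)
  show "uniformity = (INF e\<in>{0<..}. principal {(x, y :: 'a ptensor). dist x y < e})"
    by (rule uniformity_ptensor_def)
  show "open U \<longleftrightarrow> (\<forall>x\<in>U. \<forall>\<^sub>F (x', y) in uniformity. x' = x \<longrightarrow> y \<in> U)" for U :: "'a ptensor set"
    by (rule open_ptensor_def)
  show "(norm u = 0) = (u = 0)"
  proof transfer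
    fix X :: "nat \<Rightarrow> 'a atensor"
    assume "proj_equiv X X"
    then have X: "proj_Cauchy X" by (simp add: proj_equiv_def)
    show "(lim (\<lambda>n. proj_norm (X n)) = 0) = proj_equiv X (\<lambda>_. 0)"
    proof
      assume "lim (\<lambda>n. proj_norm (X n)) = 0"
      with tendsto_lim_proj_norm[OF X] show "proj_equiv X (\<lambda>_. 0)"
        by (simp add: proj_equiv_def X proj_Cauchy_const)
    next
      assume "proj_equiv X (\<lambda>_. 0)"
      then show "lim (\<lambda>n. proj_norm (X n)) = 0"
        by (intro limI) (simp add: proj_equiv_def)
    qed
  qed
  show "norm (u + v) \<le> norm u + norm v"
  proof transfer
    fix X Y :: "nat \<Rightarrow> 'a atensor"
    assume "proj_equiv X X" "proj_equiv Y Y"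
    then have XY: "proj_Cauchy X" "proj_Cauchy Y" by (simp_all add: proj_equiv_def)
    show "lim (\<lambda>n. proj_norm (X n + Y n)) \<le> lim (\<lambda>n. proj_norm (X n)) + lim (\<lambda>n. proj_norm (Y n))"
      by (rule LIMSEQ_le[OF tendsto_lim_proj_norm[OF proj_Cauchy_add[OF XY]]
            tendsto_add[OF tendsto_lim_proj_norm[OF XY(1)] tendsto_lim_proj_norm[OF XY(2)]]])
        (use proj_norm_triangle in blast)
  qed
  have C: "norm (k *\<^sub>C u) = cmod k * norm u" for k :: complex
  proof (transfer fixing: k)
    fix X :: "nat \<Rightarrow> 'a atensor"
    assume "proj_equiv X X"
    then have "(\<lambda>n. proj_norm (X n)) \<longlonglongrightarrow> lim (\<lambda>n. proj_norm (X n))"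
      by (intro tendsto_lim_proj_norm) (simp add: proj_equiv_def)
    then show "lim (\<lambda>n. proj_norm (k *\<^sub>C X n)) = cmod k * lim (\<lambda>n. proj_norm (X n))"
      unfolding proj_norm_scaleC by (intro limI tendsto_mult_left)
  qed
  show "norm (c *\<^sub>C u) = cmod c * norm u" by (rule C)
  show "norm (a *\<^sub>R u) = \<bar>a\<bar> * norm u" by (simp add: scaleR_scaleC C)
qed

end

text \<open>The canonical map of the algebraic tensor product into its completion.\<close>

definition ptensor_of :: "'a :: complex_normed_vector atensor \<Rightarrow> 'a ptensor" where
  "ptensor_of t = abs_ptensor (\<lambda>_. t)"

lemma ptensor_of_transfer [transfer_rule]: "rel_fun (=) cr_ptensor (\<lambda>t _. t) ptensor_of"
  by (auto simp: rel_fun_def cr_ptensor_def ptensor_of_def proj_equiv_refl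
      proj_Cauchy_const)

definition elem_tensor :: "'a :: complex_normed_vector \<Rightarrow> 'a \<Rightarrow> 'a ptensor" where
  "elem_tensor x y = ptensor_of (atensor_of [(x, y)])"

lemma ptensor_of_add: "ptensor_of (s + t) = ptensor_of s + ptensor_of t"
  by transfer (simp add: proj_equiv_refl proj_Cauchy_const)

lemma ptensor_of_scaleC: "ptensor_of (c *\<^sub>C t) = c *\<^sub>C ptensor_of t"
  by transfer (simp add: proj_equiv_refl proj_Cauchy_const)

lemma ptensor_of_minus: "ptensor_of (- t) = - ptensor_of t"
  using ptensor_of_scaleC[of "-1" t] by (simp add: scaleC_minus1)

lemma ptensor_of_diff: "ptensor_of (s - t) = ptensor_of s - ptensor_of t"
  using ptensor_of_add[of s "- t"] by (simp add: ptensor_of_minus)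

lemma norm_ptensor_of: "norm (ptensor_of t) = proj_norm t"
  by transfer simp

lemma ptensor_of_atensor_of: "ptensor_of (atensor_of xs) = (\<Sum>(x, y)\<leftarrow>xs. elem_tensor x y)"
proof (induction xs)
  case Nil
  have "norm (ptensor_of (atensor_of [] :: 'a atensor)) \<le> 0"
    using proj_norm_le[of "[] :: ('a \<times> 'a) list"] by (simp add: norm_ptensor_of list_cost_def)
  then show ?case by simp
next
  case (Cons p xs)
  obtain x y where p: "p = (x, y)" by (cases p)
  have "atensor_of (p # xs) = atensor_of [(x, y)] + atensor_of xs"
    using atensor_of_append[of "[(x, y)]" xs] p by simp
  with Cons p show ?case by (simp add: ptensor_of_add elem_tensor_def)
qed

lemma norm_abs_ptensor_diff:
  assumes X: "proj_Cauchy X"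
  shows "norm (abs_ptensor X - ptensor_of t) = lim (\<lambda>n. proj_norm (X n - t))"
proof -
  have eqs: "proj_equiv X X" "proj_equiv (\<lambda>_. t) (\<lambda>_. t)"
    "proj_equiv (\<lambda>n. (-1) *\<^sub>C t) (\<lambda>n. (-1) *\<^sub>C t)"
    using X by (simp_all add: proj_equiv_refl proj_Cauchy_const)
  have "abs_ptensor X - ptensor_of t = abs_ptensor X + (-1) *\<^sub>C abs_ptensor (\<lambda>_. t)"
    by (simp add: ptensor_of_def scaleC_minus1)
  also have "\<dots> = abs_ptensor (\<lambda>n. X n + (-1) *\<^sub>C t)"
    by (simp only: scaleC_ptensor.abs_eq[OF eqs(2)] plus_ptensor.abs_eq[OF eqs(1,3)])
  finally have "norm (abs_ptensor X - ptensor_of t) = lim (\<lambda>n. proj_norm (X n + (-1) *\<^sub>C t))"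
    by (simp only: norm_ptensor.abs_eq[OF proj_equiv_add[OF eqs(1,3)]])
  then show ?thesis
    by (simp add: scaleC_minus1)
qed

lemma ptensor_exhaust:
  obtains X where "proj_Cauchy X" "u = abs_ptensor X"
  by (metis Quotient_abs_rep Quotient_ptensor Quotient_rep_reflp proj_equiv_def)

lemma lim_proj_norm_diff_le:
  assumes X: "proj_Cauchy X" and N: "\<And>n. n \<ge> N \<Longrightarrow> proj_norm (X n - t) < e"
  shows "lim (\<lambda>n. proj_norm (X n - t)) \<le> e"
proof (rule LIMSEQ_le_const2)
  have "proj_Cauchy (\<lambda>n. X n - t)"
    using proj_Cauchy_add[OF X proj_Cauchy_const[of "- t"]] by simp
  then show "(\<lambda>n. proj_norm (X n - t)) \<longlonglongrightarrow> lim (\<lambda>n. proj_norm (X n - t))"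
    by (rule tendsto_lim_proj_norm)
  show "\<exists>N. \<forall>n\<ge>N. proj_norm (X n - t) \<le> e"
    using N by (meson less_imp_le)
qed

lemma abs_ptensor_approx:
  assumes X: "proj_Cauchy X" and e: "e > 0"
  shows "\<exists>N. \<forall>m\<ge>N. norm (abs_ptensor X - ptensor_of (X m)) < e"
proof -
  from e have "e / 2 > 0" by simp
  with X obtain N where N: "\<And>m n. m \<ge> N \<Longrightarrow> n \<ge> N \<Longrightarrow> proj_norm (X m - X n) < e / 2"
    unfolding proj_Cauchy_def by metis
  have "norm (abs_ptensor X - ptensor_of (X m)) < e" if "m \<ge> N" for m
  proof -
    have "lim (\<lambda>n. proj_norm (X n - X m)) \<le> e / 2"
      by (rule lim_proj_norm_diff_le[OF X, of N]) (rule N, simp_all add: that)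
    with e show ?thesis by (simp add: norm_abs_ptensor_diff[OF X])
  qed
  then show ?thesis by blast
qed

lemma ptensor_approx:
  assumes "e > 0"
  shows "\<exists>t. norm (u - ptensor_of t) < e"
proof -
  obtain X where "proj_Cauchy X" "u = abs_ptensor X" by (rule ptensor_exhaust)
  with abs_ptensor_approx[OF this(1) assms] show ?thesis by blast
qed

instance ptensor :: (complex_normed_vector) complex_banach
proof
  fix U :: "nat \<Rightarrow> 'a ptensor"
  assume U: "Cauchy U"
  have "\<exists>t. norm (U n - ptensor_of t) < inverse (real (Suc n))" for n
    by (rule ptensor_approx) simp
  then obtain X where X: "\<And>n. norm (U n - ptensor_of (X n)) < inverse (real (Suc n))"
    by metis
  have dX: "(\<lambda>n. U n - ptensor_of (X n)) \<longlonglongrightarrow> 0"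
    by (rule Lim_null_comparison[OF _ LIMSEQ_inverse_real_of_nat])
      (use X in \<open>auto intro!: always_eventually less_imp_le\<close>)
  have "Cauchy (\<lambda>n. ptensor_of (X n))"
  proof (rule metric_CauchyI)
    fix e :: real assume "e > 0"
    then have "e / 3 > 0" by simp
    with U dX obtain M N where M: "\<And>m n. m \<ge> M \<Longrightarrow> n \<ge> M \<Longrightarrow> dist (U m) (U n) < e / 3"
      and N: "\<And>n. n \<ge> N \<Longrightarrow> dist (U n - ptensor_of (X n)) 0 < e / 3"
      unfolding Cauchy_def lim_sequentially by metis
    have "dist (ptensor_of (X m)) (ptensor_of (X n)) < e" if "m \<ge> max M N" "n \<ge> max M N" for m n
    proof -
      have "dist (U m) (ptensor_of (X m)) < e / 3" "dist (U n) (ptensor_of (X n)) < e / 3"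
        using N[of m] N[of n] that by (simp_all add: dist_norm)
      moreover have "dist (U m) (U n) < e / 3" using M that by simp
      ultimately show ?thesis
        using dist_triangle[of "ptensor_of (X m)" "ptensor_of (X n)" "U m"]
          dist_triangle[of "U m" "ptensor_of (X n)" "U n"] by (simp add: dist_commute)
    qed
    then show "\<exists>M. \<forall>m\<ge>M. \<forall>n\<ge>M. dist (ptensor_of (X m)) (ptensor_of (X n)) < e" by blast
  qed
  then have CX: "proj_Cauchy X"
    by (simp add: Cauchy_def proj_Cauchy_def dist_norm ptensor_of_diff[symmetric] norm_ptensor_of)
  define u where "u = abs_ptensor X"
  have "(\<lambda>m. u - ptensor_of (X m)) \<longlonglongrightarrow> 0"
    using abs_ptensor_approx[OF CX] by (intro LIMSEQ_I) (simp add: u_def)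
  from tendsto_diff[OF dX this] have "(\<lambda>n. U n - u) \<longlonglongrightarrow> 0"
    by simp
  then have "U \<longlonglongrightarrow> u"
    by (simp add: LIM_zero_iff)
  then show "convergent U"
    unfolding convergent_def by blast
qed

text \<open>
  Bounded linear maps out of the completion are determined by, and can be built from, their values on
  elementary tensors.
\<close>

lemma bounded_clinear_add: "bounded_clinear T \<Longrightarrow> T (x + y) = T x + T y"
  by (simp add: bounded_clinear_def clinear_def)

lemma bounded_clinear_scaleC: "bounded_clinear T \<Longrightarrow> T (c *\<^sub>C x) = c *\<^sub>C T x"
  by (simp add: bounded_clinear_def clinear_def)

lemma bounded_clinear_ptensor_eqI:
  fixes S T :: "'a :: complex_normed_vector ptensor \<Rightarrow> 'b :: complex_normed_vector"
  assumes S: "bounded_clinear S" and T: "bounded_clinear T"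
    and eq: "\<And>x y. S (elem_tensor x y) = T (elem_tensor x y)"
  shows "S = T"
proof
  fix u :: "'a ptensor"
  have lin: "bounded_linear S" "bounded_linear T"
    using S T by (simp_all add: bounded_clinear_imp_bounded_linear)
  have 1: "S (ptensor_of t) = T (ptensor_of t)" for t
  proof -
    obtain xs where xs: "t = atensor_of xs" by (rule atensor_exhaust)
    have "S (\<Sum>(x, y)\<leftarrow>ys. elem_tensor x y) = T (\<Sum>(x, y)\<leftarrow>ys. elem_tensor x y)" for ys
      by (induction ys)
        (auto simp: eq lin[THEN bounded_linear.linear, THEN linear_add]
           lin[THEN bounded_linear.linear, THEN linear_0])
    then show ?thesis by (simp add: xs ptensor_of_atensor_of)
  qed
  have "\<exists>t. norm (u - ptensor_of t) < inverse (real (Suc n))" for n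
    by (rule ptensor_approx) simp
  then obtain X where X: "\<And>n. norm (u - ptensor_of (X n)) < inverse (real (Suc n))"
    by metis
  have "(\<lambda>n. ptensor_of (X n) - u) \<longlonglongrightarrow> 0"
    by (rule Lim_null_comparison[OF _ LIMSEQ_inverse_real_of_nat])
      (use X in \<open>auto intro!: always_eventually less_imp_le simp: norm_minus_commute\<close>)
  then have "(\<lambda>n. ptensor_of (X n)) \<longlonglongrightarrow> u"
    by (simp add: LIM_zero_iff)
  from lin(1)[THEN bounded_linear.tendsto, OF this] lin(2)[THEN bounded_linear.tendsto, OF this]
  show "S u = T u"
    by (simp add: 1 LIMSEQ_unique)
qed

lemma norm_elem_tensor_le: "norm (elem_tensor x y) \<le> norm x * norm y"
  using proj_norm_le[of "[(x, y)]"] by (simp add: elem_tensor_def norm_ptensor_of list_cost_def)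


section \<open>The product morphism\<close>

lemma sum_list_mult_eq:
  fixes xs ys :: "('a :: complex_banach_algebra \<times> 'a) list"
  assumes "atensor_of xs = atensor_of ys"
  shows "(\<Sum>(x, y)\<leftarrow>xs. x * y) = (\<Sum>(x, y)\<leftarrow>ys. x * y)"
proof (rule ccontr)
  assume "\<not> ?thesis"
  then have "(\<Sum>(x, y)\<leftarrow>xs. x * y) - (\<Sum>(x, y)\<leftarrow>ys. x * y) \<noteq> 0" by simp
  then obtain h :: "'a \<Rightarrow> complex" where h: "clinear h"
    and ne: "h ((\<Sum>(x, y)\<leftarrow>xs. x * y) - (\<Sum>(x, y)\<leftarrow>ys. x * y)) \<noteq> 0"
    by (rule clinear_separation)
  have add: "h (x + y) = h x + h y" for x y using h by (simp add: clinear_def)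
  have 0: "h 0 = 0" using add[of 0 0] by simp
  have diff: "h (x - y) = h x - h y" for x y using add[of "x - y" y] by simp
  have B: "cbilinear (\<lambda>x y. h (x * y))"
    using h by (simp add: cbilinear_def clinear_def algebra_simps mult_scaleC_left mult_scaleC_right)
  have "h (\<Sum>(x, y)\<leftarrow>zs. x * y) = (\<Sum>(x, y)\<leftarrow>zs. h (x * y))" for zs
    by (induction zs) (auto simp: 0 add)
  moreover have "tensor_sum xs (\<lambda>x y. h (x * y)) = tensor_sum ys (\<lambda>x y. h (x * y))"
    using assms by transfer simp
  ultimately show False
    using ne B by (simp add: diff tensor_sum_def)
qed

definition atensor_mult :: "'a :: complex_banach_algebra atensor \<Rightarrow> 'a" where
  "atensor_mult t = (THE z. \<exists>xs. atensor_of xs = t \<and> z = (\<Sum>(x, y)\<leftarrow>xs. x * y))"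

lemma atensor_mult_of: "atensor_mult (atensor_of xs) = (\<Sum>(x, y)\<leftarrow>xs. x * y)"
  unfolding atensor_mult_def by (rule the_equality) (auto dest: sum_list_mult_eq)

lemma atensor_mult_add: "atensor_mult (s + t) = atensor_mult s + atensor_mult t"
proof -
  obtain xs ys where "s = atensor_of xs" "t = atensor_of ys"
    by (metis atensor_exhaust)
  then show ?thesis by (simp add: atensor_of_append[symmetric] atensor_mult_of)
qed

lemma atensor_mult_scaleC: "atensor_mult (c *\<^sub>C t) = c *\<^sub>C atensor_mult t"
proof -
  obtain xs where t: "t = atensor_of xs" by (rule atensor_exhaust)
  have "(\<Sum>(x, y)\<leftarrow>map (\<lambda>(x, y). (c *\<^sub>C x, y)) xs. x * y) = c *\<^sub>C (\<Sum>(x, y)\<leftarrow>xs. x * y)"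
    by (induction xs) (auto simp: mult_scaleC_left scaleC_add_right)
  then show ?thesis by (simp add: t atensor_of_scaleC[symmetric] atensor_mult_of)
qed

lemma atensor_mult_diff: "atensor_mult (s - t) = atensor_mult s - atensor_mult t"
  using atensor_mult_add[of s "(-1) *\<^sub>C t"] atensor_mult_scaleC[of "-1" t]
  by (simp add: scaleC_minus1)

lemma norm_atensor_mult: "norm (atensor_mult t) \<le> proj_norm t"
proof (rule proj_norm_greatest)
  fix xs assume "atensor_of xs = t"
  moreover have "norm (\<Sum>(x, y)\<leftarrow>xs. x * y) \<le> list_cost xs"
    by (induction xs)
      (auto simp: list_cost_def intro!: order_trans[OF norm_triangle_ineq] add_mono norm_mult_ineq)
  ultimately show "norm (atensor_mult t) \<le> list_cost xs"
    by (auto simp: atensor_mult_of)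
qed

lemma atensor_mult_tendsto:
  assumes "proj_Cauchy X"
  shows "(\<lambda>n. atensor_mult (X n)) \<longlonglongrightarrow> lim (\<lambda>n. atensor_mult (X n))"
proof -
  have "Cauchy (\<lambda>n. atensor_mult (X n))"
    using assms unfolding Cauchy_def proj_Cauchy_def dist_norm atensor_mult_diff[symmetric]
    by (meson order.strict_trans1 norm_atensor_mult)
  then show ?thesis
    by (rule convergent_LIMSEQ_iff[THEN iffD1, OF Cauchy_convergent])
qed

lift_definition ptensor_mult :: "'a :: complex_banach_algebra ptensor \<Rightarrow> 'a"
  is "\<lambda>X. lim (\<lambda>n. atensor_mult (X n))"
proof -
  fix X Y :: "nat \<Rightarrow> 'a atensor"
  assume "proj_equiv X Y"
  then have XY: "proj_Cauchy X" "proj_Cauchy Y" and d: "(\<lambda>n. proj_norm (X n - Y n)) \<longlonglongrightarrow> 0"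
    by (simp_all add: proj_equiv_def)
  have "(\<lambda>n. atensor_mult (X n) - atensor_mult (Y n)) \<longlonglongrightarrow> 0"
    by (rule Lim_null_comparison[OF _ d])
      (auto simp: atensor_mult_diff[symmetric] norm_atensor_mult)
  from tendsto_add[OF this atensor_mult_tendsto[OF XY(2)]]
  show "lim (\<lambda>n. atensor_mult (X n)) = lim (\<lambda>n. atensor_mult (Y n))"
    by (simp add: limI)
qed

lemma ptensor_mult_elem: "ptensor_mult (elem_tensor x y) = x * y"
  unfolding elem_tensor_def by transfer (simp add: atensor_mult_of)

lemma norm_ptensor_mult: "norm (ptensor_mult u) \<le> norm u"
proof transfer
  fix X :: "nat \<Rightarrow> 'a atensor"
  assume "proj_equiv X X"
  then have X: "proj_Cauchy X" by (simp add: proj_equiv_def)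
  show "norm (lim (\<lambda>n. atensor_mult (X n))) \<le> lim (\<lambda>n. proj_norm (X n))"
    by (rule LIMSEQ_le[OF tendsto_norm[OF atensor_mult_tendsto[OF X]] tendsto_lim_proj_norm[OF X]])
      (auto simp: norm_atensor_mult)
qed

lemma bounded_clinear_ptensor_mult: "bounded_clinear ptensor_mult"
proof -
  have "ptensor_mult (u + v) = ptensor_mult u + ptensor_mult v" for u v :: "'a ptensor"
  proof transfer
    fix X Y :: "nat \<Rightarrow> 'a atensor"
    assume "proj_equiv X X" "proj_equiv Y Y"
    then have "proj_Cauchy X" "proj_Cauchy Y" by (simp_all add: proj_equiv_def)
    then show "lim (\<lambda>n. atensor_mult (X n + Y n))
        = lim (\<lambda>n. atensor_mult (X n)) + lim (\<lambda>n. atensor_mult (Y n))"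
      unfolding atensor_mult_add by (intro limI tendsto_add atensor_mult_tendsto)
  qed
  moreover have "ptensor_mult (c *\<^sub>C u) = c *\<^sub>C ptensor_mult u" for c and u :: "'a ptensor"
  proof (transfer fixing: c)
    fix X :: "nat \<Rightarrow> 'a atensor"
    assume "proj_equiv X X"
    then have X: "proj_Cauchy X" by (simp add: proj_equiv_def)
    have "bounded_linear (\<lambda>x :: 'a. c *\<^sub>C x)"
      by (rule bounded_linear_intro[of _ "cmod c"])
        (simp_all add: scaleC_add_right scaleR_scaleC scaleC_scaleC norm_scaleC mult.commute)
    from bounded_linear.tendsto[OF this atensor_mult_tendsto[OF X]]
    show "lim (\<lambda>n. atensor_mult (c *\<^sub>C X n)) = c *\<^sub>C lim (\<lambda>n. atensor_mult (X n))"
      unfolding atensor_mult_scaleC by (rule limI)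
  qed
  ultimately show ?thesis
    unfolding bounded_clinear_def clinear_def using norm_ptensor_mult
    by (intro conjI allI exI[of _ 1]) auto
qed


section \<open>Banach bimodules\<close>

locale banach_bimodule =
  fixes lact :: "'a :: complex_banach_algebra \<Rightarrow> 'e :: complex_banach \<Rightarrow> 'e"
    and ract :: "'e \<Rightarrow> 'a \<Rightarrow> 'e"
  assumes lact_clinear: "clinear (lact a)" "clinear (\<lambda>a. lact a x)"
    and ract_clinear: "clinear (\<lambda>x. ract x a)" "clinear (ract x)"
    and lact_mult: "lact (a * b) x = lact a (lact b x)"
    and ract_mult: "ract x (a * b) = ract (ract x a) b"
    and lact_ract: "lact a (ract x b) = ract (lact a x) b"
    and lact_bounded: "\<exists>K. \<forall>a x. norm (lact a x) \<le> K * norm a * norm x"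
    and ract_bounded: "\<exists>K. \<forall>a x. norm (ract x a) \<le> K * norm x * norm a"

lemma banach_bimodule_mult: "banach_bimodule (*) ((*) :: 'a :: complex_banach_algebra \<Rightarrow> 'a \<Rightarrow> 'a)"
proof
  fix a b x :: 'a
  show "\<exists>K. \<forall>a x :: 'a. norm (a * x) \<le> K * norm a * norm x"
    "\<exists>K. \<forall>a x :: 'a. norm (x * a) \<le> K * norm x * norm a"
    by (rule exI[of _ 1], simp add: norm_mult_ineq)+
qed (auto simp: clinear_def algebra_simps mult_scaleC_left mult_scaleC_right)

text \<open>The dual bimodule: \<open>(a \<cdot> f)(x) = f (x \<cdot> a)\<close> and \<open>(f \<cdot> a)(x) = f (a \<cdot> x)\<close>.\<close>

definition dual_lact :: "('e \<Rightarrow> 'a \<Rightarrow> 'e) \<Rightarrow> 'a \<Rightarrow> 'e :: complex_normed_vector cdual \<Rightarrow> 'e cdual" where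
  "dual_lact ract a f = cdual_of (\<lambda>x. dual_apply f (ract x a))"

definition dual_ract :: "('a \<Rightarrow> 'e \<Rightarrow> 'e) \<Rightarrow> 'e :: complex_normed_vector cdual \<Rightarrow> 'a \<Rightarrow> 'e cdual" where
  "dual_ract lact f a = cdual_of (\<lambda>x. dual_apply f (lact a x))"

context banach_bimodule
begin

lemma bounded_clinear_lact: "bounded_clinear (lact a)"
proof -
  obtain K where "\<And>a x. norm (lact a x) \<le> K * norm a * norm x" using lact_bounded by blast
  then show ?thesis unfolding bounded_clinear_def using lact_clinear by blast
qed

lemma bounded_clinear_ract: "bounded_clinear (\<lambda>x. ract x a)"
proof -
  obtain K where "\<And>a x. norm (ract x a) \<le> K * norm x * norm a" using ract_bounded by blast
  then have "\<forall>x. norm (ract x a) \<le> (K * norm a) * norm x" by (simp add: ac_simps)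
  then show ?thesis unfolding bounded_clinear_def using ract_clinear by blast
qed

lemma bounded_clinear_dual_comp:
  assumes "bounded_clinear T"
  shows "bounded_clinear (\<lambda>x. dual_apply f (T x))"
proof -
  obtain K where K: "\<And>x. norm (T x) \<le> K * norm x"
    using assms unfolding bounded_clinear_def by blast
  have "cmod (dual_apply f (T x)) \<le> (norm f * K) * norm x" for x
    using norm_dual_apply[of f "T x"] mult_left_mono[OF K[of x], of "norm f"] by (simp add: mult.assoc)
  then show ?thesis
    using assms unfolding bounded_clinear_def clinear_def
    by (auto simp: dual_apply_add dual_apply_scaleC scaleC_complex_def)
qed

lemma dual_apply_dual_lact [simp]: "dual_apply (dual_lact ract a f) x = dual_apply f (ract x a)"
  by (simp add: dual_lact_def bounded_clinear_dual_comp bounded_clinear_ract)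

lemma dual_apply_dual_ract [simp]: "dual_apply (dual_ract lact f a) x = dual_apply f (lact a x)"
  by (simp add: dual_ract_def bounded_clinear_dual_comp bounded_clinear_lact)

lemma banach_bimodule_dual: "banach_bimodule (dual_lact ract) (dual_ract lact)"
proof
  note [simp] = dual_apply_plus dual_apply_scale dual_apply_add dual_apply_scaleC scaleC_complex_def
  fix a b :: 'a and f :: "'e cdual"
  show "clinear (dual_lact ract a)" "clinear (\<lambda>f. dual_ract lact f a)"
    by (auto simp: clinear_def intro!: cdual_eqI)
  show "clinear (\<lambda>a. dual_lact ract a f)" "clinear (dual_ract lact f)"
    using lact_clinear(2) ract_clinear(2) by (auto simp: clinear_def intro!: cdual_eqI)
  show "dual_lact ract (a * b) f = dual_lact ract a (dual_lact ract b f)"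
    "dual_ract lact f (a * b) = dual_ract lact (dual_ract lact f a) b"
    "dual_lact ract a (dual_ract lact f b) = dual_ract lact (dual_lact ract a f) b"
    by (auto simp: lact_mult ract_mult lact_ract intro!: cdual_eqI)
  show "\<exists>K. \<forall>a f. norm (dual_lact ract a f) \<le> K * norm a * norm f"
  proof -
    obtain K where K: "\<And>a x. norm (ract x a) \<le> K * norm x * norm a" using ract_bounded by blast
    have "norm (dual_lact ract a f) \<le> \<bar>K\<bar> * norm a * norm f" for a f
    proof (rule norm_cdual_bound)
      fix x
      have "norm (ract x a) \<le> \<bar>K\<bar> * norm x * norm a"
        by (rule order_trans[OF K]) (intro mult_right_mono, auto)
      from mult_left_mono[OF this, of "norm f"]
      show "cmod (dual_apply (dual_lact ract a f) x) \<le> \<bar>K\<bar> * norm a * norm f * norm x"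
        using norm_dual_apply[of f "ract x a"] by (simp add: ac_simps)
    qed simp
    then show ?thesis by blast
  qed
  show "\<exists>K. \<forall>a f. norm (dual_ract lact f a) \<le> K * norm f * norm a"
  proof -
    obtain K where K: "\<And>a x. norm (lact a x) \<le> K * norm a * norm x" using lact_bounded by blast
    have "norm (dual_ract lact f a) \<le> \<bar>K\<bar> * norm f * norm a" for a f
    proof (rule norm_cdual_bound)
      fix x
      have "norm (lact a x) \<le> \<bar>K\<bar> * norm a * norm x"
        by (rule order_trans[OF K]) (intro mult_right_mono, auto)
      from mult_left_mono[OF this, of "norm f"]
      show "cmod (dual_apply (dual_ract lact f a) x) \<le> \<bar>K\<bar> * norm f * norm a * norm x"
        using norm_dual_apply[of f "lact a x"] by (simp add: ac_simps)
    qed simp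
    then show ?thesis by blast
  qed
qed

end


section \<open>The projective tensor product as a bimodule\<close>

lemma cbilinear_lmult:
  fixes B :: "'a :: complex_banach_algebra \<Rightarrow> _"
  shows "cbilinear B \<Longrightarrow> cbilinear (\<lambda>x y. B (a * x) y)"
  by (simp add: cbilinear_def clinear_def algebra_simps mult_scaleC_right)

lemma cbilinear_rmult:
  fixes B :: "'a :: complex_banach_algebra \<Rightarrow> _"
  shows "cbilinear B \<Longrightarrow> cbilinear (\<lambda>x y. B x (y * a))"
  by (simp add: cbilinear_def clinear_def algebra_simps mult_scaleC_left)

lift_definition atensor_lact :: "'a :: complex_banach_algebra \<Rightarrow> 'a atensor \<Rightarrow> 'a atensor"
  is "\<lambda>a t B. if cbilinear B then t (\<lambda>x y. B (a * x) y) else 0"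
proof -
  fix a :: 'a and t assume "t \<in> range (tensor_sum :: ('a \<times> 'a) list \<Rightarrow> _)"
  then obtain xs where "t = tensor_sum xs" by blast
  then have "(\<lambda>B. if cbilinear B then t (\<lambda>x y. B (a * x) y) else 0)
      = tensor_sum (map (\<lambda>(x, y). (a * x, y)) xs)"
    by (auto simp: tensor_sum_def fun_eq_iff cbilinear_lmult comp_def case_prod_unfold)
  then show "(\<lambda>B. if cbilinear B then t (\<lambda>x y. B (a * x) y) else 0) \<in> range tensor_sum"
    by (rule range_eqI)
qed

lift_definition atensor_ract :: "'a :: complex_banach_algebra atensor \<Rightarrow> 'a \<Rightarrow> 'a atensor"
  is "\<lambda>t a B. if cbilinear B then t (\<lambda>x y. B x (y * a)) else 0"
proof -
  fix a :: 'a and t assume "t \<in> range (tensor_sum :: ('a \<times> 'a) list \<Rightarrow> _)"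
  then obtain xs where "t = tensor_sum xs" by blast
  then have "(\<lambda>B. if cbilinear B then t (\<lambda>x y. B x (y * a)) else 0)
      = tensor_sum (map (\<lambda>(x, y). (x, y * a)) xs)"
    by (auto simp: tensor_sum_def fun_eq_iff cbilinear_rmult comp_def case_prod_unfold)
  then show "(\<lambda>B. if cbilinear B then t (\<lambda>x y. B x (y * a)) else 0) \<in> range tensor_sum"
    by (rule range_eqI)
qed

lemma atensor_lact_of: "atensor_lact a (atensor_of xs) = atensor_of (map (\<lambda>(x, y). (a * x, y)) xs)"
  by transfer (auto simp: tensor_sum_def fun_eq_iff cbilinear_lmult comp_def case_prod_unfold)

lemma atensor_ract_of: "atensor_ract (atensor_of xs) a = atensor_of (map (\<lambda>(x, y). (x, y * a)) xs)"
  by transfer (auto simp: tensor_sum_def fun_eq_iff cbilinear_rmult comp_def case_prod_unfold)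

lemma atensor_lact_add: "atensor_lact a (s + t) = atensor_lact a s + atensor_lact a t"
  by transfer (auto simp: fun_eq_iff)

lemma atensor_ract_add: "atensor_ract (s + t) a = atensor_ract s a + atensor_ract t a"
  by transfer (auto simp: fun_eq_iff)

lemma atensor_lact_scaleC: "atensor_lact a (c *\<^sub>C t) = c *\<^sub>C atensor_lact a t"
  by transfer (auto simp: fun_eq_iff)

lemma atensor_ract_scaleC: "atensor_ract (c *\<^sub>C t) a = c *\<^sub>C atensor_ract t a"
  by transfer (auto simp: fun_eq_iff)

lemma atensor_lact_diff: "atensor_lact a (s - t) = atensor_lact a s - atensor_lact a t"
  using atensor_lact_add[of a s "(-1) *\<^sub>C t"] atensor_lact_scaleC[of a "-1" t]
  by (simp add: scaleC_minus1)

lemma atensor_ract_diff: "atensor_ract (s - t) a = atensor_ract s a - atensor_ract t a"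
  using atensor_ract_add[of s "(-1) *\<^sub>C t" a] atensor_ract_scaleC[of "-1" t a]
  by (simp add: scaleC_minus1)

lemma list_cost_lmult:
  "list_cost (map (\<lambda>(x, y). (a * x, y)) xs) \<le> norm (a :: 'a :: real_normed_algebra) * list_cost xs"
proof (induction xs)
  case (Cons p xs)
  obtain x y where p: "p = (x, y)" by (cases p)
  show ?case
    using Cons mult_right_mono[OF norm_mult_ineq[of a x], of "norm y"]
    by (simp add: p list_cost_def algebra_simps)
qed (simp add: list_cost_def)

lemma list_cost_rmult:
  "list_cost (map (\<lambda>(x, y). (x, y * a)) xs) \<le> norm (a :: 'a :: real_normed_algebra) * list_cost xs"
proof (induction xs)
  case (Cons p xs)
  obtain x y where p: "p = (x, y)" by (cases p)
  show ?case
    using Cons mult_left_mono[OF norm_mult_ineq[of y a], of "norm x"]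
    by (simp add: p list_cost_def algebra_simps)
qed (simp add: list_cost_def)

lemma proj_norm_bound_from_lists:
  assumes "0 \<le> k"
    and "\<And>xs. \<exists>ys. T (atensor_of xs) = atensor_of ys \<and> list_cost ys \<le> k * list_cost xs"
  shows "proj_norm (T t) \<le> k * proj_norm t"
proof (cases "k = 0")
  case True
  obtain xs where "t = atensor_of xs" by (rule atensor_exhaust)
  with assms(2)[of xs] True show ?thesis
    using proj_norm_le order_trans by fastforce
next
  case False
  with assms(1) have k: "k > 0" by simp
  have "proj_norm (T t) / k \<le> proj_norm t"
  proof (rule proj_norm_greatest)
    fix xs assume "atensor_of xs = t"
    then show "proj_norm (T t) / k \<le> list_cost xs"
      using assms(2)[of xs] proj_norm_le k
      by (metis mult.commute order_trans pos_divide_le_eq)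
  qed
  with k show ?thesis by (simp add: field_simps)
qed

lemma proj_norm_lact: "proj_norm (atensor_lact a t) \<le> norm a * proj_norm t"
proof (rule proj_norm_bound_from_lists)
  show "\<exists>ys. atensor_lact a (atensor_of xs) = atensor_of ys \<and> list_cost ys \<le> norm a * list_cost xs" for xs
    using atensor_lact_of list_cost_lmult by blast
qed simp

lemma proj_norm_ract: "proj_norm (atensor_ract t a) \<le> norm a * proj_norm t"
proof (rule proj_norm_bound_from_lists[where T = "\<lambda>t. atensor_ract t a"])
  show "\<exists>ys. atensor_ract (atensor_of xs) a = atensor_of ys \<and> list_cost ys \<le> norm a * list_cost xs" for xs
    using atensor_ract_of list_cost_rmult by blast
qed simp

lift_definition ptensor_lact :: "'a :: complex_banach_algebra \<Rightarrow> 'a ptensor \<Rightarrow> 'a ptensor"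
  is "\<lambda>a X n. atensor_lact a (X n)"
  by (rule proj_equiv_image) (auto intro: atensor_lact_diff proj_norm_lact)

lift_definition ptensor_ract :: "'a :: complex_banach_algebra ptensor \<Rightarrow> 'a \<Rightarrow> 'a ptensor"
  is "\<lambda>X a n. atensor_ract (X n) a"
  by (rule proj_equiv_image[where T = "\<lambda>t. atensor_ract t _"]) (auto intro: atensor_ract_diff proj_norm_ract)

lemma ptensor_lact_elem: "ptensor_lact a (elem_tensor b c) = elem_tensor (a * b) c"
  unfolding elem_tensor_def
  by transfer (simp add: atensor_lact_of proj_equiv_refl proj_Cauchy_const)

lemma ptensor_ract_elem: "ptensor_ract (elem_tensor b c) a = elem_tensor b (c * a)"
  unfolding elem_tensor_def
  by transfer (simp add: atensor_ract_of proj_equiv_refl proj_Cauchy_const)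

lemma cbilinearD:
  assumes "cbilinear B"
  shows "B (x + x') y = B x y + B x' y" "B x (y + y') = B x y + B x y'"
    "B (c *\<^sub>C x) y = c * B x y" "B x (c *\<^sub>C y) = c * B x y"
  using assms unfolding cbilinear_def clinear_def scaleC_complex_def by blast+

lemma elem_tensor_bilinear:
  "elem_tensor (x + x') y = elem_tensor x y + elem_tensor x' y"
  "elem_tensor x (y + y') = elem_tensor x y + elem_tensor x y'"
  "elem_tensor (c *\<^sub>C x) y = c *\<^sub>C elem_tensor x y"
  "elem_tensor x (c *\<^sub>C y) = c *\<^sub>C elem_tensor x y"
proof -
  have "atensor_of [(x + x', y)] = atensor_of [(x, y)] + atensor_of [(x', y)]"
    "atensor_of [(x, y + y')] = atensor_of [(x, y)] + atensor_of [(x, y')]"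
    "atensor_of [(c *\<^sub>C x, y)] = c *\<^sub>C atensor_of [(x, y)]"
    "atensor_of [(x, c *\<^sub>C y)] = c *\<^sub>C atensor_of [(x, y)]"
    by (transfer, simp add: tensor_sum_def fun_eq_iff cbilinearD)+
  then show "elem_tensor (x + x') y = elem_tensor x y + elem_tensor x' y"
    "elem_tensor x (y + y') = elem_tensor x y + elem_tensor x y'"
    "elem_tensor (c *\<^sub>C x) y = c *\<^sub>C elem_tensor x y"
    "elem_tensor x (c *\<^sub>C y) = c *\<^sub>C elem_tensor x y"
    by (simp_all add: elem_tensor_def ptensor_of_add ptensor_of_scaleC)
qed

lemma norm_ptensor_map_le:
  assumes X: "proj_Cauchy X" and T: "proj_equiv (\<lambda>n. T (X n)) (\<lambda>n. T (X n))"
    and le: "\<And>t. proj_norm (T t) \<le> k * proj_norm t"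
  shows "lim (\<lambda>n. proj_norm (T (X n))) \<le> k * lim (\<lambda>n. proj_norm (X n))"
proof (rule LIMSEQ_le)
  show "(\<lambda>n. proj_norm (T (X n))) \<longlonglongrightarrow> lim (\<lambda>n. proj_norm (T (X n)))"
    using T by (intro tendsto_lim_proj_norm) (simp add: proj_equiv_def)
  show "(\<lambda>n. k * proj_norm (X n)) \<longlonglongrightarrow> k * lim (\<lambda>n. proj_norm (X n))"
    by (intro tendsto_mult_left tendsto_lim_proj_norm X)
qed (use le in blast)

lemma proj_equiv_lact:
  "proj_Cauchy X \<Longrightarrow> proj_equiv (\<lambda>n. atensor_lact a (X n)) (\<lambda>n. atensor_lact a (X n))"
  by (rule proj_equiv_image[OF proj_equiv_refl atensor_lact_diff proj_norm_lact])

lemma proj_equiv_ract: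
  "proj_Cauchy X \<Longrightarrow> proj_equiv (\<lambda>n. atensor_ract (X n) a) (\<lambda>n. atensor_ract (X n) a)"
  by (rule proj_equiv_image[where T = "\<lambda>t. atensor_ract t a", OF proj_equiv_refl atensor_ract_diff proj_norm_ract])

lemma norm_ptensor_lact: "norm (ptensor_lact a u) \<le> norm a * norm u"
proof -
  obtain X where X: "proj_Cauchy X" "u = abs_ptensor X" by (rule ptensor_exhaust)
  have eqs: "proj_equiv X X" "proj_equiv (\<lambda>n. atensor_lact a (X n)) (\<lambda>n. atensor_lact a (X n))"
    using X(1) by (rule proj_equiv_refl, rule proj_equiv_lact)
  show ?thesis
    by (simp only: X(2) ptensor_lact.abs_eq[OF eqs(1)] norm_ptensor.abs_eq[OF eqs(1)]
        norm_ptensor.abs_eq[OF eqs(2)]) (rule norm_ptensor_map_le[OF X(1) eqs(2) proj_norm_lact])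
qed

lemma norm_ptensor_ract: "norm (ptensor_ract u a) \<le> norm u * norm a"
proof -
  obtain X where X: "proj_Cauchy X" "u = abs_ptensor X" by (rule ptensor_exhaust)
  have eqs: "proj_equiv X X" "proj_equiv (\<lambda>n. atensor_ract (X n) a) (\<lambda>n. atensor_ract (X n) a)"
    using X(1) by (rule proj_equiv_refl, rule proj_equiv_ract)
  have "norm (ptensor_ract u a) \<le> norm a * norm u"
    by (simp only: X(2) ptensor_ract.abs_eq[OF eqs(1)] norm_ptensor.abs_eq[OF eqs(1)]
        norm_ptensor.abs_eq[OF eqs(2)])
      (rule norm_ptensor_map_le[where T = "\<lambda>t. atensor_ract t a", OF X(1) eqs(2) proj_norm_ract])
  then show ?thesis by (simp add: mult.commute)
qed

lemma bounded_clinear_ptensor_lact: "bounded_clinear (ptensor_lact a)"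
proof -
  have "ptensor_lact a (u + v) = ptensor_lact a u + ptensor_lact a v"
    "ptensor_lact a (c *\<^sub>C u) = c *\<^sub>C ptensor_lact a u" for u v c
  proof -
    obtain X Y where X: "proj_Cauchy X" "u = abs_ptensor X" and Y: "proj_Cauchy Y" "v = abs_ptensor Y"
      by (metis ptensor_exhaust)
    note T = proj_equiv_lact[where a = a]
    note eqs = proj_equiv_refl[OF X(1)] proj_equiv_refl[OF Y(1)]
    show "ptensor_lact a (u + v) = ptensor_lact a u + ptensor_lact a v"
      by (simp only: X(2) Y(2) plus_ptensor.abs_eq[OF eqs] ptensor_lact.abs_eq[OF eqs(1)]
          ptensor_lact.abs_eq[OF eqs(2)] ptensor_lact.abs_eq[OF proj_equiv_add[OF eqs]]
          plus_ptensor.abs_eq[OF T T, OF X(1) Y(1)] atensor_lact_add)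
    show "ptensor_lact a (c *\<^sub>C u) = c *\<^sub>C ptensor_lact a u"
      by (simp only: X(2) scaleC_ptensor.abs_eq[OF eqs(1)] ptensor_lact.abs_eq[OF eqs(1)]
          ptensor_lact.abs_eq[OF proj_equiv_scaleC[OF eqs(1)]]
          scaleC_ptensor.abs_eq[OF T, OF X(1)] atensor_lact_scaleC)
  qed
  then show ?thesis
    unfolding bounded_clinear_def clinear_def using norm_ptensor_lact by blast
qed

lemma bounded_clinear_ptensor_ract: "bounded_clinear (\<lambda>u. ptensor_ract u a)"
proof -
  have "ptensor_ract (u + v) a = ptensor_ract u a + ptensor_ract v a"
    "ptensor_ract (c *\<^sub>C u) a = c *\<^sub>C ptensor_ract u a" for u v c
  proof -
    obtain X Y where X: "proj_Cauchy X" "u = abs_ptensor X" and Y: "proj_Cauchy Y" "v = abs_ptensor Y"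
      by (metis ptensor_exhaust)
    note T = proj_equiv_ract[where a = a]
    note eqs = proj_equiv_refl[OF X(1)] proj_equiv_refl[OF Y(1)]
    show "ptensor_ract (u + v) a = ptensor_ract u a + ptensor_ract v a"
      by (simp only: X(2) Y(2) plus_ptensor.abs_eq[OF eqs] ptensor_ract.abs_eq[OF eqs(1)]
          ptensor_ract.abs_eq[OF eqs(2)] ptensor_ract.abs_eq[OF proj_equiv_add[OF eqs]]
          plus_ptensor.abs_eq[OF T T, OF X(1) Y(1)] atensor_ract_add)
    show "ptensor_ract (c *\<^sub>C u) a = c *\<^sub>C ptensor_ract u a"
      by (simp only: X(2) scaleC_ptensor.abs_eq[OF eqs(1)] ptensor_ract.abs_eq[OF eqs(1)]
          ptensor_ract.abs_eq[OF proj_equiv_scaleC[OF eqs(1)]]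
          scaleC_ptensor.abs_eq[OF T, OF X(1)] atensor_ract_scaleC)
  qed
  moreover have "\<exists>K. \<forall>u. norm (ptensor_ract u a) \<le> K * norm u"
    using norm_ptensor_ract by (metis mult.commute)
  ultimately show ?thesis
    unfolding bounded_clinear_def clinear_def by blast
qed

lemma bounded_clinear_comp:
  assumes "bounded_clinear S" "bounded_clinear T"
  shows "bounded_clinear (\<lambda>x. S (T x))"
proof -
  obtain K L where K: "\<And>x. norm (S x) \<le> K * norm x" and L: "\<And>x. norm (T x) \<le> L * norm x"
    using assms unfolding bounded_clinear_def by metis
  have "norm (S (T x)) \<le> (\<bar>K\<bar> * L) * norm x" for x
  proof -
    have "norm (S (T x)) \<le> \<bar>K\<bar> * norm (T x)"
      by (rule order_trans[OF K]) (intro mult_right_mono, auto)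
    also have "\<dots> \<le> \<bar>K\<bar> * (L * norm x)"
      by (intro mult_left_mono L) simp
    finally show ?thesis by (simp add: mult.assoc)
  qed
  with assms show ?thesis
    unfolding bounded_clinear_def clinear_def by auto
qed

lemma bounded_clinear_plus:
  assumes "bounded_clinear S" "bounded_clinear T"
  shows "bounded_clinear (\<lambda>x. S x + T x)"
proof -
  obtain K L where K: "\<And>x. norm (S x) \<le> K * norm x" and L: "\<And>x. norm (T x) \<le> L * norm x"
    using assms unfolding bounded_clinear_def by metis
  have "norm (S x + T x) \<le> (K + L) * norm x" for x
    using norm_triangle_ineq[of "S x" "T x"] K[of x] L[of x] by (simp add: algebra_simps)
  then have "\<exists>K. \<forall>x. norm (S x + T x) \<le> K * norm x" by blast
  with assms show ?thesis
    unfolding bounded_clinear_def clinear_def by (simp add: scaleC_add_right algebra_simps)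
qed

lemma bounded_clinear_scale: "bounded_clinear (\<lambda>x. c *\<^sub>C x)"
  unfolding bounded_clinear_def clinear_def
  by (auto simp: scaleC_add_right scaleC_scaleC mult.commute norm_scaleC intro!: exI[of _ "cmod c"])

lemma banach_bimodule_ptensor:
  "banach_bimodule ptensor_lact (ptensor_ract :: 'a :: complex_banach_algebra ptensor \<Rightarrow> _)"
proof
  note bc = bounded_clinear_ptensor_lact bounded_clinear_ptensor_ract
  note elem = ptensor_lact_elem ptensor_ract_elem elem_tensor_bilinear algebra_simps
    mult_scaleC_left mult_scaleC_right
  fix a b :: 'a and u :: "'a ptensor"
  show "clinear (ptensor_lact a)" "clinear (\<lambda>u. ptensor_ract u a)"
    using bc by (auto simp: bounded_clinear_def)
  have "ptensor_lact (a + b) = (\<lambda>u. ptensor_lact a u + ptensor_lact b u)" for a b :: 'a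
    by (rule bounded_clinear_ptensor_eqI[OF bc(1) bounded_clinear_plus[OF bc(1) bc(1)]]) (simp add: elem)
  moreover have "ptensor_lact (c *\<^sub>C a) = (\<lambda>u. c *\<^sub>C ptensor_lact a u)" for c and a :: 'a
    by (rule bounded_clinear_ptensor_eqI[OF bc(1) bounded_clinear_comp[OF bounded_clinear_scale bc(1)]])
      (simp add: elem)
  ultimately show "clinear (\<lambda>a. ptensor_lact a u)"
    by (simp add: clinear_def)
  have "(\<lambda>u. ptensor_ract u (a + b)) = (\<lambda>u. ptensor_ract u a + ptensor_ract u b)" for a b :: 'a
    by (rule bounded_clinear_ptensor_eqI[OF bc(2) bounded_clinear_plus[OF bc(2) bc(2)]]) (simp add: elem)
  moreover have "(\<lambda>u. ptensor_ract u (c *\<^sub>C a)) = (\<lambda>u. c *\<^sub>C ptensor_ract u a)" for c and a :: 'a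
    by (rule bounded_clinear_ptensor_eqI[OF bc(2) bounded_clinear_comp[OF bounded_clinear_scale bc(2)]])
      (simp add: elem)
  ultimately show "clinear (ptensor_ract u)"
    by (simp add: clinear_def fun_eq_iff)
  have "ptensor_lact (a * b) = (\<lambda>u. ptensor_lact a (ptensor_lact b u))"
    by (rule bounded_clinear_ptensor_eqI[OF bc(1) bounded_clinear_comp[OF bc(1) bc(1)]])
      (simp add: ptensor_lact_elem mult.assoc)
  then show "ptensor_lact (a * b) u = ptensor_lact a (ptensor_lact b u)" by simp
  have "(\<lambda>u. ptensor_ract u (a * b)) = (\<lambda>u. ptensor_ract (ptensor_ract u a) b)"
    by (rule bounded_clinear_ptensor_eqI[OF bc(2) bounded_clinear_comp[OF bc(2) bc(2)]])
      (simp add: ptensor_ract_elem mult.assoc)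
  then show "ptensor_ract u (a * b) = ptensor_ract (ptensor_ract u a) b" by (rule fun_cong)
  have "(\<lambda>u. ptensor_lact a (ptensor_ract u b)) = (\<lambda>u. ptensor_ract (ptensor_lact a u) b)"
    by (rule bounded_clinear_ptensor_eqI[OF bounded_clinear_comp[OF bc(1) bc(2)]
          bounded_clinear_comp[OF bc(2) bc(1)]]) (simp add: ptensor_lact_elem ptensor_ract_elem)
  then show "ptensor_lact a (ptensor_ract u b) = ptensor_ract (ptensor_lact a u) b" by (rule fun_cong)
  show "\<exists>K. \<forall>a u. norm (ptensor_lact a u) \<le> K * norm a * norm (u :: 'a ptensor)"
    by (rule exI[of _ 1]) (simp add: norm_ptensor_lact)
  show "\<exists>K. \<forall>a u. norm (ptensor_ract u a) \<le> K * norm (u :: 'a ptensor) * norm a"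
    by (rule exI[of _ 1]) (simp add: norm_ptensor_ract)
qed

lemma ptensor_mult_lact: "ptensor_mult (ptensor_lact a u) = a * ptensor_mult u"
proof -
  have "(\<lambda>u. ptensor_mult (ptensor_lact a u)) = (\<lambda>u. a * ptensor_mult u)"
    by (rule bounded_clinear_ptensor_eqI[
          OF bounded_clinear_comp[OF bounded_clinear_ptensor_mult bounded_clinear_ptensor_lact]
          bounded_clinear_comp[OF banach_bimodule.bounded_clinear_lact[OF banach_bimodule_mult]
            bounded_clinear_ptensor_mult]])
      (simp add: ptensor_lact_elem ptensor_mult_elem mult.assoc)
  then show ?thesis by (rule fun_cong)
qed

lemma ptensor_mult_ract: "ptensor_mult (ptensor_ract u a) = ptensor_mult u * a"
proof -
  have "(\<lambda>u. ptensor_mult (ptensor_ract u a)) = (\<lambda>u. ptensor_mult u * a)"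
    by (rule bounded_clinear_ptensor_eqI[
          OF bounded_clinear_comp[OF bounded_clinear_ptensor_mult bounded_clinear_ptensor_ract]
          bounded_clinear_comp[OF banach_bimodule.bounded_clinear_ract[OF banach_bimodule_mult]
            bounded_clinear_ptensor_mult]])
      (simp add: ptensor_ract_elem ptensor_mult_elem mult.assoc)
  then show ?thesis by (rule fun_cong)
qed


section \<open>Weak topologies and duals of subspaces\<close>

text \<open>The coarsest topology that makes every functional in \<open>F\<close> continuous.\<close>

definition functional_topology :: "('b \<Rightarrow> complex) set \<Rightarrow> 'b topology" where
  "functional_topology F = topology_generated_by {f -` U | f U. f \<in> F \<and> open U}"

definition weak_topology :: "'e :: complex_normed_vector topology" where
  "weak_topology = functional_topology (range dual_apply)"

definition wkstar_topology :: "'a :: complex_normed_vector cdual set \<Rightarrow> 'a topology" where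
  "wkstar_topology Astar = functional_topology (dual_apply ` Astar)"

text \<open>
  The dual of a subspace \<open>S\<close> consists of functions on the ambient space that are fixed
  (to \<open>undefined\<close>) outside of \<open>S\<close>, so that equality of functions is equality on \<open>S\<close>.
\<close>

definition subspace_dual :: "'e :: complex_normed_vector set \<Rightarrow> ('e \<Rightarrow> complex) set" where
  "subspace_dual S = {\<Phi> \<in> extensional S.
     (\<forall>x\<in>S. \<forall>y\<in>S. \<Phi> (x + y) = \<Phi> x + \<Phi> y) \<and>
     (\<forall>c. \<forall>x\<in>S. \<Phi> (c *\<^sub>C x) = c * \<Phi> x) \<and>
     (\<exists>K. \<forall>x\<in>S. cmod (\<Phi> x) \<le> K * norm x)}"

definition subspace_dual_norm :: "'e :: complex_normed_vector set \<Rightarrow> ('e \<Rightarrow> complex) \<Rightarrow> real" where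
  "subspace_dual_norm S \<Phi> = (SUP x\<in>{x \<in> S. norm x \<le> 1}. cmod (\<Phi> x))"

definition subspace_dual_lact ::
    "'e set \<Rightarrow> ('e \<Rightarrow> 'a \<Rightarrow> 'e) \<Rightarrow> 'a \<Rightarrow> ('e \<Rightarrow> complex) \<Rightarrow> ('e \<Rightarrow> complex)" where
  "subspace_dual_lact S ract a \<Phi> = restrict (\<lambda>x. \<Phi> (ract x a)) S"

definition subspace_dual_ract ::
    "'e set \<Rightarrow> ('a \<Rightarrow> 'e \<Rightarrow> 'e) \<Rightarrow> ('e \<Rightarrow> complex) \<Rightarrow> 'a \<Rightarrow> ('e \<Rightarrow> complex)" where
  "subspace_dual_ract S lact \<Phi> a = restrict (\<lambda>x. \<Phi> (lact a x)) S"


section \<open>Dual Banach algebras and approximate Connes-biprojectivity\<close>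

text \<open>
  \<open>\<A> = (\<A>\<^sub>*)\<^sup>*\<close> means that the canonical map \<open>\<A> \<rightarrow> (\<A>\<^sub>*)\<^sup>*\<close>, which is always
  linear and contractive, is bijective. By the open mapping theorem it is then an isomorphism of Banach
  spaces; it need not be isometric.
\<close>

definition dual_banach_algebra :: "'a :: complex_banach_algebra cdual set \<Rightarrow> bool" where
  "dual_banach_algebra Astar \<longleftrightarrow>
     closed Astar \<and> 0 \<in> Astar \<and>
     (\<forall>f\<in>Astar. \<forall>g\<in>Astar. f + g \<in> Astar) \<and>
     (\<forall>c. \<forall>f\<in>Astar. c *\<^sub>C f \<in> Astar) \<and>
     (\<forall>a. \<forall>f\<in>Astar. dual_lact (*) a f \<in> Astar \<and> dual_ract (*) f a \<in> Astar) \<and>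
     bij_betw (\<lambda>a. restrict (\<lambda>f. dual_apply f a) Astar) UNIV (subspace_dual Astar)"

definition sigma_wc ::
    "'a :: complex_banach_algebra cdual set \<Rightarrow> ('a \<Rightarrow> 'e \<Rightarrow> 'e) \<Rightarrow> ('e \<Rightarrow> 'a \<Rightarrow> 'e) \<Rightarrow>
      'e :: complex_banach set" where
  "sigma_wc Astar lact ract =
     {x. continuous_map (wkstar_topology Astar) weak_topology (\<lambda>a. lact a x) \<and>
         continuous_map (wkstar_topology Astar) weak_topology (\<lambda>a. ract x a)}"

definition sigma_wc_tensor_dual ::
    "'a :: complex_banach_algebra cdual set \<Rightarrow> 'a ptensor cdual set" where
  "sigma_wc_tensor_dual Astar =
     sigma_wc Astar (dual_lact ptensor_ract) (dual_ract ptensor_lact)"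

definition ptensor_mult_adjoint :: "'a :: complex_banach_algebra cdual \<Rightarrow> 'a ptensor cdual" where
  "ptensor_mult_adjoint f = cdual_of (\<lambda>u. dual_apply f (ptensor_mult u))"

text \<open>
  The adjoint of \<open>ptensor_mult_adjoint\<close> on the predual, with values in \<open>(\<A>\<^sub>*)\<^sup>* = \<A>\<close>.
\<close>

definition pi_sigma_wc ::
    "'a :: complex_banach_algebra cdual set \<Rightarrow> ('a ptensor cdual \<Rightarrow> complex) \<Rightarrow> 'a" where
  "pi_sigma_wc Astar \<Phi> = (THE a. \<forall>f\<in>Astar. dual_apply f a = \<Phi> (ptensor_mult_adjoint f))"

definition continuous_bimodule_morphism ::
    "'a :: complex_banach_algebra cdual set \<Rightarrow> ('a \<Rightarrow> 'a ptensor cdual \<Rightarrow> complex) \<Rightarrow> bool" where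
  "continuous_bimodule_morphism Astar \<rho> \<longleftrightarrow> (let S = sigma_wc_tensor_dual Astar in
     (\<forall>a. \<rho> a \<in> subspace_dual S) \<and>
     (\<forall>a b. \<forall>F\<in>S. \<rho> (a + b) F = \<rho> a F + \<rho> b F) \<and>
     (\<forall>c a. \<forall>F\<in>S. \<rho> (c *\<^sub>C a) F = c * \<rho> a F) \<and>
     (\<exists>K. \<forall>a. subspace_dual_norm S (\<rho> a) \<le> K * norm a) \<and>
     (\<forall>a b. \<rho> (a * b) = subspace_dual_lact S (dual_ract ptensor_lact) a (\<rho> b)) \<and>
     (\<forall>a b. \<rho> (a * b) = subspace_dual_ract S (dual_lact ptensor_ract) (\<rho> a) b))"

definition directed_set :: "'i set \<Rightarrow> ('i \<Rightarrow> 'i \<Rightarrow> bool) \<Rightarrow> bool" where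
  "directed_set I le \<longleftrightarrow> I \<noteq> {} \<and> (\<forall>i\<in>I. le i i) \<and>
     (\<forall>i\<in>I. \<forall>j\<in>I. \<forall>k\<in>I. le i j \<longrightarrow> le j k \<longrightarrow> le i k) \<and>
     (\<forall>i\<in>I. \<forall>j\<in>I. \<exists>k\<in>I. le i k \<and> le j k)"

definition net_filter :: "'i set \<Rightarrow> ('i \<Rightarrow> 'i \<Rightarrow> bool) \<Rightarrow> 'i filter" where
  "net_filter I le = (INF i\<in>I. principal {j \<in> I. le i j})"

text \<open>
  The index set of the net is drawn from the type \<open>'i\<close>. A theorem that assumes this predicate for
  a type variable \<open>'i\<close> covers nets over arbitrary directed sets.
\<close>

definition approximately_Connes_biprojective ::
    "'i itself \<Rightarrow> 'a :: complex_banach_algebra cdual set \<Rightarrow> bool" where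
  "approximately_Connes_biprojective (_ :: 'i itself) Astar \<longleftrightarrow>
     (\<exists>(I :: 'i set) le \<rho>. directed_set I le \<and>
        (\<forall>i\<in>I. continuous_bimodule_morphism Astar (\<rho> i)) \<and>
        (\<forall>a. ((\<lambda>i. pi_sigma_wc Astar (\<rho> i a)) \<longlongrightarrow> a) (net_filter I le)))"

definition wkstar_characters ::
    "'a :: complex_banach_algebra cdual set \<Rightarrow> ('a \<Rightarrow> complex) set" where
  "wkstar_characters Astar = {\<phi>. clinear \<phi> \<and> (\<forall>x y. \<phi> (x * y) = \<phi> x * \<phi> y) \<and>
     (\<exists>x. \<phi> x \<noteq> 0) \<and> continuous_map (wkstar_topology Astar) euclidean \<phi>}"

definition left_contractible :: "('a :: complex_banach_algebra \<Rightarrow> complex) \<Rightarrow> bool" where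
  "left_contractible \<phi> \<longleftrightarrow> (\<exists>m. (\<forall>a. a * m = \<phi> a *\<^sub>C m) \<and> \<phi> m = 1)"


section \<open>The adjoint of the product morphism is well defined\<close>

lemma continuous_map_functional_topology:
  assumes "F \<noteq> {}" "\<And>g. g \<in> G \<Longrightarrow> (\<lambda>x. g (h x)) \<in> F" "G \<noteq> {}"
  shows "continuous_map (functional_topology F) (functional_topology G) h"
  unfolding functional_topology_def[of G]
proof (rule continuous_on_generated_topo)
  fix V assume "V \<in> {g -` U | g U. g \<in> G \<and> open U}"
  then obtain g U where V: "V = g -` U" "g \<in> G" "open U" by blast
  then have "h -` V = (\<lambda>x. g (h x)) -` U" by auto
  with V assms(2) have "openin (functional_topology F) (h -` V)"
    unfolding functional_topology_def openin_topology_generated_by_iff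
    by (auto intro!: generate_topology_on.Basis)
  then show "openin (functional_topology F) (h -` V \<inter> topspace (functional_topology F))"
    by (intro openin_Int openin_topspace)
next
  obtain g where "g \<in> G" using assms(3) by blast
  then have "UNIV \<in> {g -` U | g U. g \<in> G \<and> open U}"
    by (force intro: exI[of _ g] exI[of _ UNIV])
  then show "h ` topspace (functional_topology F) \<subseteq> \<Union> {g -` U | g U. g \<in> G \<and> open U}"
    by blast
qed

lemma dual_apply_ptensor_mult_adjoint [simp]:
  "dual_apply (ptensor_mult_adjoint f) u = dual_apply f (ptensor_mult u)"
  by (simp add: ptensor_mult_adjoint_def bounded_clinear_ptensor_mult
      bounded_clinear_comp[OF bounded_clinear_dual_apply])

lemma predual_evaluation:
  assumes "dual_banach_algebra Astar" "\<Phi> \<in> subspace_dual Astar"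
  shows "\<exists>!a. \<forall>f\<in>Astar. dual_apply f a = \<Phi> f"
proof -
  have bij: "bij_betw (\<lambda>a. restrict (\<lambda>f. dual_apply f a) Astar) UNIV (subspace_dual Astar)"
    using assms(1) by (simp add: dual_banach_algebra_def)
  with assms(2) obtain a where a: "\<Phi> = restrict (\<lambda>f. dual_apply f a) Astar"
    unfolding bij_betw_def by blast
  show ?thesis
  proof (rule ex1I[of _ a])
    fix b assume "\<forall>f\<in>Astar. dual_apply f b = \<Phi> f"
    then have "restrict (\<lambda>f. dual_apply f b) Astar = restrict (\<lambda>f. dual_apply f a) Astar"
      by (auto simp: a fun_eq_iff restrict_def)
    with bij show "b = a"
      unfolding bij_betw_def inj_on_def by blast
  qed (simp add: a)
qed

lemma ptensor_mult_adjoint_linear: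
  "ptensor_mult_adjoint (f + g) = ptensor_mult_adjoint f + ptensor_mult_adjoint g"
  "ptensor_mult_adjoint (c *\<^sub>C f) = c *\<^sub>C ptensor_mult_adjoint f"
  by (auto intro!: cdual_eqI simp: dual_apply_plus dual_apply_scale)

lemma norm_ptensor_mult_adjoint: "norm (ptensor_mult_adjoint f) \<le> norm f"
proof (rule norm_cdual_bound)
  fix u
  have "cmod (dual_apply f (ptensor_mult u)) \<le> norm f * norm (ptensor_mult u)"
    by (rule norm_dual_apply)
  also have "\<dots> \<le> norm f * norm u"
    by (intro mult_left_mono norm_ptensor_mult) simp
  finally show "cmod (dual_apply (ptensor_mult_adjoint f) u) \<le> norm f * norm u" by simp
qed simp

lemma subspace_dual_pullback:
  assumes A: "dual_banach_algebra Astar" and \<Phi>: "\<Phi> \<in> subspace_dual S"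
    and S: "\<And>f. f \<in> Astar \<Longrightarrow> ptensor_mult_adjoint f \<in> S"
  shows "restrict (\<lambda>f. \<Phi> (ptensor_mult_adjoint f)) Astar \<in> subspace_dual Astar"
proof -
  obtain K where K: "\<And>x. x \<in> S \<Longrightarrow> cmod (\<Phi> x) \<le> K * norm x"
    using \<Phi> unfolding subspace_dual_def by blast
  have "cmod (\<Phi> (ptensor_mult_adjoint f)) \<le> \<bar>K\<bar> * norm f" if "f \<in> Astar" for f
  proof -
    have "cmod (\<Phi> (ptensor_mult_adjoint f)) \<le> \<bar>K\<bar> * norm (ptensor_mult_adjoint f)"
      by (rule order_trans[OF K[OF S[OF that]]]) (intro mult_right_mono, auto)
    also have "\<dots> \<le> \<bar>K\<bar> * norm f"
      by (intro mult_left_mono norm_ptensor_mult_adjoint) simp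
    finally show ?thesis .
  qed
  then have "\<exists>K. \<forall>f\<in>Astar. cmod (\<Phi> (ptensor_mult_adjoint f)) \<le> K * norm f" by blast
  then show ?thesis
    using A \<Phi> S unfolding subspace_dual_def dual_banach_algebra_def
    by (simp add: ptensor_mult_adjoint_linear)
qed

lemma ptensor_mult_adjoint_sigma_wc:
  assumes A: "dual_banach_algebra Astar" and f: "f \<in> Astar"
  shows "ptensor_mult_adjoint f \<in> sigma_wc_tensor_dual Astar"
proof -
  interpret T: banach_bimodule "ptensor_lact :: 'a \<Rightarrow> _" ptensor_ract by (rule banach_bimodule_ptensor)
  interpret M: banach_bimodule "(*) :: 'a \<Rightarrow> _" "(*)" by (rule banach_bimodule_mult)
  have sub: "dual_lact (*) a f \<in> Astar" "dual_ract (*) f a \<in> Astar" for a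
    using A f by (simp_all add: dual_banach_algebra_def)
  have adj: "dual_lact ptensor_ract a (ptensor_mult_adjoint f) = ptensor_mult_adjoint (dual_lact (*) a f)"
    "dual_ract ptensor_lact (ptensor_mult_adjoint f) a = ptensor_mult_adjoint (dual_ract (*) f a)" for a
    by (auto intro!: cdual_eqI simp: ptensor_mult_lact ptensor_mult_ract)
  have "\<exists>x. \<forall>g\<in>Astar. dual_apply G (ptensor_mult_adjoint g) = dual_apply g x" for G
  proof -
    have "dual_apply G \<in> subspace_dual UNIV"
      using bounded_clinear_dual_apply[of G]
      by (simp add: subspace_dual_def bounded_clinear_def clinear_def scaleC_complex_def)
    from subspace_dual_pullback[OF A this]
    have "restrict (\<lambda>g. dual_apply G (ptensor_mult_adjoint g)) Astar \<in> subspace_dual Astar" by simp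
    from predual_evaluation[OF A this] obtain x where
      "\<forall>g\<in>Astar. dual_apply g x = dual_apply G (ptensor_mult_adjoint g)"
      by (auto elim!: ex1E)
    then show ?thesis by (intro exI[of _ x]) simp
  qed
  then obtain x where x: "\<And>G g. g \<in> Astar \<Longrightarrow> dual_apply G (ptensor_mult_adjoint g) = dual_apply g (x G)"
    by metis
  have "(\<lambda>a. dual_apply G (ptensor_mult_adjoint (dual_lact (*) a f))) = dual_apply (dual_ract (*) f (x G))"
    "(\<lambda>a. dual_apply G (ptensor_mult_adjoint (dual_ract (*) f a))) = dual_apply (dual_lact (*) (x G) f)" for G
    by (auto simp: x sub fun_eq_iff)
  then show ?thesis
    unfolding sigma_wc_tensor_dual_def sigma_wc_def wkstar_topology_def weak_topology_def
      mem_Collect_eq adj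
    using f sub by (auto intro!: continuous_map_functional_topology)
qed

lemma dual_apply_pi_sigma_wc:
  assumes A: "dual_banach_algebra Astar"
    and \<Phi>: "\<Phi> \<in> subspace_dual (sigma_wc_tensor_dual Astar)" and f: "f \<in> Astar"
  shows "dual_apply f (pi_sigma_wc Astar \<Phi>) = \<Phi> (ptensor_mult_adjoint f)"
proof -
  have "\<exists>!a. \<forall>f\<in>Astar. dual_apply f a = \<Phi> (ptensor_mult_adjoint f)"
    using predual_evaluation[OF A subspace_dual_pullback[OF A \<Phi> ptensor_mult_adjoint_sigma_wc[OF A]]]
    by simp
  from theI'[OF this] f show ?thesis
    unfolding pi_sigma_wc_def by blast
qed

end

theory Submission
  imports Defs
begin

text \<open>
  For \<open>f \<in> \<A>\<^sub>*\<close> the functional \<open>f \<otimes> \<phi>\<close> lies in \<open>\<sigma>wc(\<A> \<otimes> \<A>)\<^sup>*\<close>, with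
  \<open>a \<cdot> (f \<otimes> \<phi>) = \<phi>(a) (f \<otimes> \<phi>)\<close> and \<open>(f \<otimes> \<phi>) \<cdot> a = (f \<cdot> a) \<otimes> \<phi>\<close>. A bimodule morphism \<open>\<rho>\<close>
  therefore satisfies \<open>\<rho>(a l)(f \<otimes> \<phi>) = \<phi>(l) \<rho>(a)(f \<otimes> \<phi>)\<close>, so that \<open>x \<mapsto> \<rho>(x)(f \<otimes> \<phi>)\<close>
  vanishes on the closure of \<open>\<A> ker \<phi>\<close>, which is \<open>ker \<phi>\<close>. Fix \<open>b\<close> with \<open>\<phi>(b) = 1\<close> and let \<open>n \<in> \<A> = (\<A>\<^sub>*)\<^sup>*\<close> be
  the element \<open>f \<mapsto> \<rho>(b)(f \<otimes> \<phi>)\<close>. As \<open>ab - \<phi>(a)b \<in> ker \<phi>\<close>, it satisfies \<open>an = \<phi>(a)n\<close>. Since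
  \<open>\<phi> \<in> \<A>\<^sub>*\<close> and \<open>\<phi> \<otimes> \<phi>\<close> is the pullback of \<open>\<phi>\<close> along the product morphism, \<open>\<phi>(n)\<close> is the value of \<open>\<phi>\<close> at
  the image of \<open>\<rho>(b)\<close> in \<open>\<A>\<close>, which is nonzero far enough along the net.
\<close>

section \<open>Functionals on the projective tensor product\<close>

lemma tensor_sum_bound:
  assumes B: "cbilinear B" and K: "\<And>x y. cmod (B x y) \<le> K * (norm x * norm y)"
  shows "cmod (tensor_sum xs B) \<le> K * list_cost xs"
proof (induction xs)
  case (Cons p xs)
  obtain x y where p: "p = (x, y)" by (cases p)
  have "tensor_sum (p # xs) B = B x y + tensor_sum xs B"
    using B by (simp add: tensor_sum_def p)
  moreover have "list_cost (p # xs) = norm x * norm y + list_cost xs"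
    by (simp add: list_cost_def p)
  ultimately show ?case
    using norm_triangle_ineq[of "B x y" "tensor_sum xs B"] K[of x y] Cons
    by (simp add: distrib_left)
qed (use B in \<open>simp add: tensor_sum_def list_cost_def\<close>)

text \<open>A tensor is realised as a functional on bilinear forms, so
  \<open>Rep_atensor t B\<close> is already the linearisation of \<open>B\<close> at
  \<open>t\<close>. The bound holds for every list representing \<open>t\<close>, hence for the
  infimum of their costs.\<close>

lemma norm_Rep_atensor_le:
  assumes B: "cbilinear B" and K: "0 \<le> K" "\<And>x y. cmod (B x y) \<le> K * (norm x * norm y)"
  shows "cmod (Rep_atensor t B) \<le> K * proj_norm t"
proof (cases "K = 0")
  case True
  obtain xs where "t = atensor_of xs" by (rule atensor_exhaust)
  then show ?thesis
    using tensor_sum_bound[OF B K(2), of xs] True by (simp add: atensor_of.rep_eq)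
next
  case False
  with K have pos: "K > 0" by simp
  have "cmod (Rep_atensor t B) / K \<le> proj_norm t"
  proof (rule proj_norm_greatest)
    fix xs assume "atensor_of xs = t"
    then show "cmod (Rep_atensor t B) / K \<le> list_cost xs"
      using tensor_sum_bound[OF B K(2), of xs] pos
      by (auto simp: atensor_of.rep_eq field_simps)
  qed
  with pos show ?thesis by (simp add: field_simps)
qed

text \<open>The linearisation of \<open>B\<close> extended to the completion along the Cauchy
  sequence that \<open>rep_ptensor\<close> selects. For bounded bilinear \<open>B\<close>,
  \<open>Rep_atensor_tendsto\<close> shows that every representative gives the same limit.\<close>

definition ptensor_ext :: "('a :: complex_normed_vector \<Rightarrow> 'a \<Rightarrow> complex) \<Rightarrow> 'a ptensor \<Rightarrow> complex" where
  "ptensor_ext B u = lim (\<lambda>n. Rep_atensor (rep_ptensor u n) B)"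

lemma Rep_atensor_diff: "Rep_atensor (s - t) B = Rep_atensor s B - Rep_atensor t B"
  unfolding minus_atensor_def plus_atensor.rep_eq uminus_atensor.rep_eq by simp

context
  fixes B :: "'a :: complex_normed_vector \<Rightarrow> 'a \<Rightarrow> complex" and K :: real
  assumes B: "cbilinear B" and K: "0 \<le> K" "\<And>x y. cmod (B x y) \<le> K * (norm x * norm y)"
begin

text \<open>Evaluation at \<open>B\<close> is Lipschitz for the projective norm, so it preserves
  Cauchy sequences and gives equivalent sequences the same limit.\<close>

lemma Rep_atensor_tendsto:
  assumes X: "proj_Cauchy X"
  shows "(\<lambda>n. Rep_atensor (X n) B) \<longlonglongrightarrow> ptensor_ext B (abs_ptensor X)"
proof -
  define Y where "Y = rep_ptensor (abs_ptensor X)"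
  have XX: "proj_equiv X X" using X by (rule proj_equiv_refl)
  have XY: "proj_equiv Y X"
    unfolding Y_def by (rule Quotient_rep_abs[OF Quotient_ptensor, OF XX])
  then have Y: "proj_Cauchy Y" and d: "(\<lambda>n. proj_norm (Y n - X n)) \<longlonglongrightarrow> 0"
    by (simp_all add: proj_equiv_def)
  have bound: "cmod (Rep_atensor s B - Rep_atensor t B) \<le> K * proj_norm (s - t)" for s t
    using norm_Rep_atensor_le[OF B K, of "s - t"] by (simp add: Rep_atensor_diff)
  have "Cauchy (\<lambda>n. Rep_atensor (Y n) B)"
  proof (rule metric_CauchyI)
    fix e :: real assume "e > 0"
    \<comment> \<open>The divisor \<open>K + 1\<close> stays positive when \<open>K\<close> is
      zero.\<close>
    then have "e / (K + 1) > 0" using K(1) by simp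
    with Y obtain N where
      N: "\<And>m n. m \<ge> N \<Longrightarrow> n \<ge> N \<Longrightarrow> proj_norm (Y m - Y n) < e / (K + 1)"
      unfolding proj_Cauchy_def by metis
    have "dist (Rep_atensor (Y m) B) (Rep_atensor (Y n) B) < e" if "m \<ge> N" "n \<ge> N" for m n
    proof -
      have "dist (Rep_atensor (Y m) B) (Rep_atensor (Y n) B) \<le> K * proj_norm (Y m - Y n)"
        using bound by (simp add: dist_norm)
      also have "\<dots> \<le> (K + 1) * proj_norm (Y m - Y n)"
        by (intro mult_right_mono proj_norm_nonneg) simp
      also have "\<dots> < e"
        using N[OF that] K(1) by (simp add: field_simps)
      finally show ?thesis .
    qed
    then show "\<exists>N. \<forall>m\<ge>N. \<forall>n\<ge>N. dist (Rep_atensor (Y m) B) (Rep_atensor (Y n) B) < e" by blast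
  qed
  then have Ylim: "(\<lambda>n. Rep_atensor (Y n) B) \<longlonglongrightarrow> ptensor_ext B (abs_ptensor X)"
    unfolding ptensor_ext_def Y_def
    by (rule convergent_LIMSEQ_iff[THEN iffD1, OF Cauchy_convergent])
  have "(\<lambda>n. Rep_atensor (Y n) B - Rep_atensor (X n) B) \<longlonglongrightarrow> 0"
    by (rule Lim_null_comparison[OF _ tendsto_mult_right_zero[OF d, of K]]) (simp add: bound)
  from tendsto_diff[OF Ylim this] show ?thesis by simp
qed

lemma ptensor_ext_elem: "ptensor_ext B (elem_tensor x y) = B x y"
proof -
  have "Rep_atensor (atensor_of [(x, y)]) B = B x y"
    using B by (simp add: atensor_of.rep_eq tensor_sum_def)
  moreover have "(\<lambda>n. Rep_atensor (atensor_of [(x, y)]) B) \<longlonglongrightarrow> ptensor_ext B (elem_tensor x y)"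
    unfolding elem_tensor_def ptensor_of_def by (rule Rep_atensor_tendsto) (rule proj_Cauchy_const)
  ultimately show ?thesis by (simp add: LIMSEQ_const_iff)
qed

lemma norm_ptensor_ext: "cmod (ptensor_ext B u) \<le> K * norm u"
proof -
  obtain X where X: "proj_Cauchy X" "u = abs_ptensor X" by (rule ptensor_exhaust)
  have "norm u = lim (\<lambda>n. proj_norm (X n))"
    by (simp add: X(2) norm_ptensor.abs_eq[OF proj_equiv_refl[OF X(1)]])
  then have "(\<lambda>n. K * proj_norm (X n)) \<longlonglongrightarrow> K * norm u"
    using tendsto_lim_proj_norm[OF X(1)] by (simp add: tendsto_mult_left)
  then show ?thesis
    by (rule LIMSEQ_le[OF tendsto_norm[OF Rep_atensor_tendsto[OF X(1), folded X(2)]]])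
      (use norm_Rep_atensor_le[OF B K] in blast)
qed

lemma bounded_clinear_ptensor_ext: "bounded_clinear (ptensor_ext B)"
proof -
  have "ptensor_ext B (u + v) = ptensor_ext B u + ptensor_ext B v"
    "ptensor_ext B (c *\<^sub>C u) = c * ptensor_ext B u" for u v c
  proof -
    obtain X Y where X: "proj_Cauchy X" "u = abs_ptensor X" and Y: "proj_Cauchy Y" "v = abs_ptensor Y"
      by (metis ptensor_exhaust)
    note eqs = proj_equiv_refl[OF X(1)] proj_equiv_refl[OF Y(1)]
    have uv: "u + v = abs_ptensor (\<lambda>n. X n + Y n)" "c *\<^sub>C u = abs_ptensor (\<lambda>n. c *\<^sub>C X n)"
      by (simp_all add: X(2) Y(2) plus_ptensor.abs_eq[OF eqs] scaleC_ptensor.abs_eq[OF eqs(1)])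
    have cX: "proj_Cauchy (\<lambda>n. c *\<^sub>C X n)"
      using proj_equiv_scaleC[OF eqs(1), of c] by (simp add: proj_equiv_def)
    have "(\<lambda>n. Rep_atensor (X n) B + Rep_atensor (Y n) B) \<longlonglongrightarrow> ptensor_ext B (u + v)"
      using Rep_atensor_tendsto[OF proj_Cauchy_add[OF X(1) Y(1)]]
      by (simp add: uv plus_atensor.rep_eq)
    moreover have "(\<lambda>n. Rep_atensor (X n) B + Rep_atensor (Y n) B) \<longlonglongrightarrow> ptensor_ext B u + ptensor_ext B v"
      unfolding X(2) Y(2) by (intro tendsto_add Rep_atensor_tendsto X(1) Y(1))
    ultimately show "ptensor_ext B (u + v) = ptensor_ext B u + ptensor_ext B v"
      by (rule LIMSEQ_unique)
    have "(\<lambda>n. c * Rep_atensor (X n) B) \<longlonglongrightarrow> ptensor_ext B (c *\<^sub>C u)"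
      using Rep_atensor_tendsto[OF cX] by (simp add: uv scaleC_atensor.rep_eq)
    moreover have "(\<lambda>n. c * Rep_atensor (X n) B) \<longlonglongrightarrow> c * ptensor_ext B u"
      unfolding X(2) by (intro tendsto_mult_left Rep_atensor_tendsto X(1))
    ultimately show "ptensor_ext B (c *\<^sub>C u) = c * ptensor_ext B u"
      by (rule LIMSEQ_unique)
  qed
  then show ?thesis
    unfolding bounded_clinear_def clinear_def scaleC_complex_def using norm_ptensor_ext by blast
qed

end

section \<open>Tensor products of two functionals\<close>

definition dual_tensor :: "'a :: complex_normed_vector cdual \<Rightarrow> 'a cdual \<Rightarrow> 'a ptensor cdual" where
  "dual_tensor f g = cdual_of (ptensor_ext (\<lambda>x y. dual_apply f x * dual_apply g y))"

lemma cbilinear_dual_apply: "cbilinear (\<lambda>x y. dual_apply f x * dual_apply g y)"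
  by (simp add: cbilinear_def clinear_def scaleC_complex_def dual_apply_add dual_apply_scaleC
      algebra_simps)

lemma norm_dual_apply_mult:
  "cmod (dual_apply f x * dual_apply g y) \<le> norm f * norm g * (norm x * norm y)"
  using mult_mono[OF norm_dual_apply[of f x] norm_dual_apply[of g y]]
  by (simp add: norm_mult ac_simps)

lemma dual_tensor_eq: "dual_apply (dual_tensor f g) = ptensor_ext (\<lambda>x y. dual_apply f x * dual_apply g y)"
  unfolding dual_tensor_def
  by (rule dual_apply_cdual_of)
    (rule bounded_clinear_ptensor_ext[OF cbilinear_dual_apply _ norm_dual_apply_mult], simp)

lemma dual_tensor_elem [simp]:
  "dual_apply (dual_tensor f g) (elem_tensor x y) = dual_apply f x * dual_apply g y"
  unfolding dual_tensor_eq
  by (rule ptensor_ext_elem[OF cbilinear_dual_apply _ norm_dual_apply_mult]) simp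

lemma norm_dual_tensor: "norm (dual_tensor f g) \<le> norm f * norm g"
  by (rule norm_cdual_bound)
    (auto simp: dual_tensor_eq intro: norm_ptensor_ext[OF cbilinear_dual_apply _ norm_dual_apply_mult])

lemma ptensor_cdual_eqI:
  assumes "\<And>x y. dual_apply F (elem_tensor x y) = dual_apply G (elem_tensor x y)"
  shows "F = G"
proof -
  have "dual_apply F = dual_apply G"
    by (rule bounded_clinear_ptensor_eqI[OF bounded_clinear_dual_apply bounded_clinear_dual_apply assms])
  then show ?thesis by (intro cdual_eqI) simp
qed

lemma dual_tensor_add: "dual_tensor (f + g) h = dual_tensor f h + dual_tensor g h"
  by (rule ptensor_cdual_eqI) (simp add: dual_apply_plus algebra_simps)

lemma dual_tensor_scaleC: "dual_tensor (c *\<^sub>C f) h = c *\<^sub>C dual_tensor f h"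
  by (rule ptensor_cdual_eqI) (simp add: dual_apply_scale)

lemma dual_ract_dual_tensor:
  "dual_ract ptensor_lact (dual_tensor f g) a = dual_tensor (dual_ract (*) f a) g"
proof -
  interpret T: banach_bimodule "ptensor_lact :: 'a \<Rightarrow> _" ptensor_ract by (rule banach_bimodule_ptensor)
  interpret M: banach_bimodule "(*) :: 'a \<Rightarrow> _" "(*)" by (rule banach_bimodule_mult)
  show ?thesis
    by (rule ptensor_cdual_eqI) (simp add: ptensor_lact_elem)
qed

text \<open>The left action on the dual transposes right multiplication in the second factor, where
  the character splits as p(ya) = p(y)p(a).\<close>

lemma dual_lact_dual_tensor:
  assumes "\<And>x y. dual_apply p (x * y) = dual_apply p x * dual_apply p y"
  shows "dual_lact ptensor_ract a (dual_tensor f p) = dual_apply p a *\<^sub>C dual_tensor f p"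
proof -
  interpret T: banach_bimodule "ptensor_lact :: 'a \<Rightarrow> _" ptensor_ract by (rule banach_bimodule_ptensor)
  show ?thesis
    by (rule ptensor_cdual_eqI) (simp add: ptensor_ract_elem assms dual_apply_scale)
qed

lemma dual_tensor_character:
  assumes "\<And>x y. dual_apply p (x * y) = dual_apply p x * dual_apply p y"
  shows "dual_tensor p p = ptensor_mult_adjoint p"
  by (rule ptensor_cdual_eqI) (simp add: assms ptensor_mult_elem)

section \<open>Weak-star continuous functionals\<close>

lemma functional_in_span:
  assumes "finite F" "F \<subseteq> Astar" "clinear h"
    and A: "0 \<in> Astar" "\<And>f g. f \<in> Astar \<Longrightarrow> g \<in> Astar \<Longrightarrow> f + g \<in> Astar"
      "\<And>c f. f \<in> Astar \<Longrightarrow> c *\<^sub>C f \<in> Astar"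
    and "\<And>x. (\<And>f. f \<in> F \<Longrightarrow> dual_apply f x = 0) \<Longrightarrow> h x = 0"
  shows "\<exists>p\<in>Astar. h = dual_apply p"
  using assms(1-3,7)
proof (induction F arbitrary: h rule: finite_induct)
  case empty
  have "dual_apply (0 :: 'a cdual) x = 0" for x
    by transfer simp
  with empty A(1) show ?case by (intro bexI[of _ 0]) auto
next
  case (insert f F)
  show ?case
  proof (cases "\<exists>z. (\<forall>g\<in>F. dual_apply g z = 0) \<and> dual_apply f z \<noteq> 0")
    case False
    show ?thesis
    proof (rule insert.IH)
      show "F \<subseteq> Astar" "clinear h" using insert.prems by auto
      show "h x = 0" if "\<And>g. g \<in> F \<Longrightarrow> dual_apply g x = 0" for x
        using insert.prems(3)[of x] that False by auto
    qed
  next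
    case True
    then obtain z where z: "\<And>g. g \<in> F \<Longrightarrow> dual_apply g z = 0" "dual_apply f z \<noteq> 0" by blast
    \<comment> \<open>The coefficient of \<open>f\<close>, chosen so that \<open>h'\<close> vanishes
      at \<open>z\<close>.\<close>
    define c where "c = h z / dual_apply f z"
    define h' where "h' x = h x - c * dual_apply f x" for x
    have h: "h (x + y) = h x + h y" "h (k *\<^sub>C x) = k * h x" for x y k
      using insert.prems(2) by (simp_all add: clinear_def scaleC_complex_def)
    have "\<exists>p\<in>Astar. h' = dual_apply p"
    proof (rule insert.IH)
      show "F \<subseteq> Astar" using insert.prems by auto
      show "clinear h'"
        by (simp add: clinear_def h'_def h scaleC_complex_def dual_apply_add dual_apply_scaleC
            algebra_simps)
      fix x assume x: "\<And>g. g \<in> F \<Longrightarrow> dual_apply g x = 0"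
      \<comment> \<open>Shifting \<open>x\<close> along \<open>z\<close> makes \<open>f\<close>
        vanish as well and keeps every member of \<open>F\<close> zero, so the hypothesis on
        \<open>h\<close> applies.\<close>
      define k where "k = dual_apply f x / dual_apply f z"
      have "h (x + (- k) *\<^sub>C z) = 0"
      proof (rule insert.prems(3))
        fix g assume "g \<in> insert f F"
        then show "dual_apply g (x + (- k) *\<^sub>C z) = 0"
          using x z by (auto simp: dual_apply_add dual_apply_scaleC k_def)
      qed
      then show "h' x = 0"
        by (simp only: h) (simp add: h'_def c_def k_def)
    qed
    then obtain p where p: "p \<in> Astar" "h' = dual_apply p" by blast
    have "h = dual_apply (p + c *\<^sub>C f)"
      using p(2) by (simp add: fun_eq_iff h'_def dual_apply_plus dual_apply_scale diff_eq_eq)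
    moreover have "p + c *\<^sub>C f \<in> Astar"
      using p(1) insert.prems(1) A by auto
    ultimately show ?thesis by blast
  qed
qed

text \<open>A weak-star neighbourhood of 0 restricts only finitely many functionals. By induction on
  the generation of open sets: an intersection merges two finite sets, a union keeps the one for a
  member containing 0.\<close>

lemma wkstar_open_contains_kernel:
  assumes "openin (wkstar_topology Astar) V" "0 \<in> V"
  shows "\<exists>F. finite F \<and> F \<subseteq> Astar \<and> {x. \<forall>f\<in>F. dual_apply f x = 0} \<subseteq> V"
proof -
  have "generate_topology_on {f -` U |f U. f \<in> dual_apply ` Astar \<and> open U} V"
    using assms(1)
    by (simp add: wkstar_topology_def functional_topology_def openin_topology_generated_by_iff)
  then show ?thesis
    using assms(2)
  proof (induction V rule: generate_topology_on.induct)
    case Empty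
    then show ?case by simp
  next
    case (Int V W)
    then obtain F G where "finite F" "F \<subseteq> Astar" "{x. \<forall>f\<in>F. dual_apply f x = 0} \<subseteq> V"
      "finite G" "G \<subseteq> Astar" "{x. \<forall>f\<in>G. dual_apply f x = 0} \<subseteq> W" by auto
    then show ?case by (intro exI[of _ "F \<union> G"]) auto
  next
    case (UN \<V>)
    then obtain V where "V \<in> \<V>" "0 \<in> V" by blast
    with UN.IH[of V] show ?case by blast
  next
    case (Basis V)
    then obtain f U where V: "V = dual_apply f -` U" "f \<in> Astar" by auto
    have "dual_apply f 0 = 0" using dual_apply_diff[of f 0 0] by simp
    with V Basis.prems show ?case by (intro exI[of _ "{f}"]) auto
  qed
qed

text \<open>Continuity bounds \<open>h\<close> by 1 on the common kernel of finitely many predual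
  elements. A functional bounded on a subspace vanishes there, so \<open>h\<close> is a combination
  of these elements.\<close>

lemma wkstar_continuous_in_predual:
  assumes A: "dual_banach_algebra Astar" and h: "clinear h"
    and cont: "continuous_map (wkstar_topology Astar) euclidean h"
  shows "\<exists>p\<in>Astar. h = dual_apply p"
proof -
  have scale: "h (c *\<^sub>C x) = c * h x" for c x
    using h by (simp add: clinear_def scaleC_complex_def)
  have h0: "h 0 = 0" using scale[of 0 0] by simp
  define V where "V = {x \<in> topspace (wkstar_topology Astar). h x \<in> ball 0 1}"
  \<comment> \<open>The zero functional makes the generating family nonempty; the preimage of the
    whole plane then covers the space.\<close>
  have "0 \<in> Astar" using A by (simp add: dual_banach_algebra_def)
  then have "topspace (wkstar_topology Astar) = UNIV"
    unfolding wkstar_topology_def functional_topology_def topology_generated_by_topspace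
    by (auto intro!: exI[of _ UNIV])
  then have V: "V = {x. cmod (h x) < 1}" by (auto simp: V_def)
  have "openin (wkstar_topology Astar) V"
    unfolding V_def using cont by (rule openin_continuous_map_preimage) simp
  from wkstar_open_contains_kernel[OF this] obtain F where
    F: "finite F" "F \<subseteq> Astar" "{x. \<forall>f\<in>F. dual_apply f x = 0} \<subseteq> V"
    by (auto simp: V h0)
  show ?thesis
  proof (rule functional_in_span[OF F(1,2) h])
    fix x assume x: "\<And>f. f \<in> F \<Longrightarrow> dual_apply f x = 0"
    show "h x = 0"
    proof (rule ccontr)
      assume ne: "h x \<noteq> 0"
      \<comment> \<open>This multiple of \<open>x\<close> stays in the common kernel but has value 1
        under \<open>h\<close>.\<close>
      have "inverse (h x) *\<^sub>C x \<in> V"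
        using F(3) x by (auto simp: dual_apply_scaleC)
      with ne show False by (simp add: V scale)
    qed
  qed (use A in \<open>auto simp: dual_banach_algebra_def\<close>)
qed

section \<open>Contractibility\<close>

text \<open>The usual operator norm estimate by normalising \<open>x\<close>. Membership in
  \<open>S\<close> is asked only along the complex line through \<open>x\<close>, which is easy to
  check when \<open>S\<close> is \<open>sigma_wc_tensor_dual\<close>.\<close>

lemma subspace_dual_norm_bound:
  assumes \<Phi>: "\<Phi> \<in> subspace_dual S" and x: "\<And>c. c *\<^sub>C x \<in> S"
  shows "cmod (\<Phi> x) \<le> subspace_dual_norm S \<Phi> * norm x"
proof (cases "x = 0")
  case True
  have "x \<in> S" using x[of 1] by simp
  then have "\<Phi> (0 *\<^sub>C x) = 0 * \<Phi> x"
    using \<Phi> unfolding subspace_dual_def by blast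
  with True show ?thesis by simp
next
  case False
  obtain K where K: "\<And>y. y \<in> S \<Longrightarrow> cmod (\<Phi> y) \<le> K * norm y"
    using \<Phi> unfolding subspace_dual_def by blast
  \<comment> \<open>A real supremum dominates its members only once the set is known to be bounded
    above.\<close>
  have bdd: "bdd_above ((\<lambda>y. cmod (\<Phi> y)) ` {y \<in> S. norm y \<le> 1})"
  proof (rule bdd_aboveI2)
    fix y assume y: "y \<in> {y \<in> S. norm y \<le> 1}"
    have "K * norm y \<le> \<bar>K\<bar> * 1"
      using y by (intro mult_mono) auto
    with K[of y] y show "cmod (\<Phi> y) \<le> \<bar>K\<bar>" by simp
  qed
  define c where "c = complex_of_real (inverse (norm x))"
  have xS: "x \<in> S" using x[of 1] by simp
  have "c *\<^sub>C x \<in> {y \<in> S. norm y \<le> 1}"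
    using x[of c] False by (simp add: c_def norm_scaleC norm_inverse)
  then have "cmod (\<Phi> (c *\<^sub>C x)) \<le> subspace_dual_norm S \<Phi>"
    unfolding subspace_dual_norm_def using bdd by (rule cSUP_upper)
  moreover have "\<Phi> (c *\<^sub>C x) = c * \<Phi> x"
    using \<Phi> xS unfolding subspace_dual_def by blast
  moreover have "cmod c = inverse (norm x)"
    by (simp add: c_def norm_inverse)
  ultimately have "inverse (norm x) * cmod (\<Phi> x) \<le> subspace_dual_norm S \<Phi>"
    by (simp add: norm_mult)
  with False show ?thesis
    by (simp add: field_simps)
qed

text \<open>Fixing the second factor turns \<Phi> into a bounded functional on the predual, which is
  evaluation at an element of the algebra. It serves both for functionals on the whole tensor dual
  and for those on its \<open>sigma_wc\<close> part.\<close>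

lemma dual_tensor_slice:
  assumes A: "dual_banach_algebra Astar" and \<Phi>: "\<Phi> \<in> subspace_dual S"
    and S: "\<And>f. f \<in> Astar \<Longrightarrow> dual_tensor f g \<in> S"
  shows "\<exists>x. \<forall>f\<in>Astar. dual_apply f x = \<Phi> (dual_tensor f g)"
proof -
  obtain K where K: "\<And>x. x \<in> S \<Longrightarrow> cmod (\<Phi> x) \<le> K * norm x"
    using \<Phi> unfolding subspace_dual_def by blast
  have "cmod (\<Phi> (dual_tensor f g)) \<le> (\<bar>K\<bar> * norm g) * norm f" if "f \<in> Astar" for f
  proof -
    have "cmod (\<Phi> (dual_tensor f g)) \<le> \<bar>K\<bar> * norm (dual_tensor f g)"
      by (rule order_trans[OF K[OF S[OF that]]]) (intro mult_right_mono, auto)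
    also have "\<dots> \<le> \<bar>K\<bar> * (norm f * norm g)"
      by (intro mult_left_mono norm_dual_tensor) simp
    finally show ?thesis by (simp add: ac_simps)
  qed
  then have "\<exists>K. \<forall>f\<in>Astar. cmod (\<Phi> (dual_tensor f g)) \<le> K * norm f" by blast
  then have "restrict (\<lambda>f. \<Phi> (dual_tensor f g)) Astar \<in> subspace_dual Astar"
    using A \<Phi> S unfolding subspace_dual_def dual_banach_algebra_def
    by (simp add: dual_tensor_add dual_tensor_scaleC)
  from predual_evaluation[OF A this] show ?thesis by auto
qed

text \<open>Weak continuity is tested against each \<open>G\<close> in the second dual of the tensor
  product. If x represents the slice of \<open>G\<close> at \<open>p\<close>, the right action gives
  a \<mapsto> f(ax), which is the predual element x \<cdot> f; the left action gives a scalar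
  multiple of \<open>p\<close>.\<close>

lemma dual_tensor_sigma_wc:
  assumes A: "dual_banach_algebra Astar" and f: "f \<in> Astar" and p: "p \<in> Astar"
    and mult: "\<And>x y. dual_apply p (x * y) = dual_apply p x * dual_apply p y"
  shows "dual_tensor f p \<in> sigma_wc_tensor_dual Astar"
proof -
  interpret M: banach_bimodule "(*) :: 'a \<Rightarrow> _" "(*)" by (rule banach_bimodule_mult)
  have sub: "dual_lact (*) a f \<in> Astar" "dual_ract (*) f a \<in> Astar" for a
    using A f by (simp_all add: dual_banach_algebra_def)
  have scale: "c *\<^sub>C p \<in> Astar" for c
    using A p by (simp add: dual_banach_algebra_def)
  have "\<exists>x. \<forall>g\<in>Astar. dual_apply g x = dual_apply G (dual_tensor g p)" for G
  proof (rule dual_tensor_slice[OF A])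
    show "dual_apply G \<in> subspace_dual UNIV"
      using bounded_clinear_dual_apply[of G]
      by (simp add: subspace_dual_def bounded_clinear_def clinear_def scaleC_complex_def)
  qed simp
  then obtain x where x: "\<And>G g. g \<in> Astar \<Longrightarrow> dual_apply G (dual_tensor g p) = dual_apply g (x G)"
    by metis
  have "(\<lambda>a. dual_apply G (dual_tensor (dual_ract (*) f a) p)) = dual_apply (dual_lact (*) (x G) f)"
    "(\<lambda>a. dual_apply G (dual_apply p a *\<^sub>C dual_tensor f p))
      = dual_apply (dual_apply G (dual_tensor f p) *\<^sub>C p)" for G
    by (auto simp: x sub fun_eq_iff dual_apply_scaleC dual_apply_scale)
  then show ?thesis
    unfolding sigma_wc_tensor_dual_def sigma_wc_def wkstar_topology_def weak_topology_def
      mem_Collect_eq dual_lact_dual_tensor[OF mult] dual_ract_dual_tensor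
    using f sub scale by (auto intro!: continuous_map_functional_topology)
qed

section \<open>Nets as filters\<close>

lemma net_filter_neq_bot:
  assumes "directed_set I le"
  shows "net_filter I le \<noteq> bot"
proof -
  \<comment> \<open>Directedness makes the tails a filter base; each tail contains its own index, so
    the filter is proper.\<close>
  have "\<exists>k\<in>I. principal {l \<in> I. le k l} \<le> inf (principal {l \<in> I. le i l}) (principal {l \<in> I. le j l})"
    if ij: "i \<in> I" "j \<in> I" for i j
  proof -
    obtain k where "k \<in> I" "le i k" "le j k"
      using assms ij unfolding directed_set_def by blast
    with assms ij have "k \<in> I" "{l \<in> I. le k l} \<subseteq> {l \<in> I. le i l} \<inter> {l \<in> I. le j l}"
      unfolding directed_set_def by blast+
    then show ?thesis by auto
  qed
  moreover have "I \<noteq> {}" "\<And>i. i \<in> I \<Longrightarrow> le i i"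
    using assms unfolding directed_set_def by auto
  ultimately show ?thesis
    unfolding net_filter_def
    by (subst INF_filter_bot_base) (auto simp: principal_eq_bot_iff)
qed

lemma net_filter_index: "directed_set I le \<Longrightarrow> eventually (\<lambda>i. i \<in> I) (net_filter I le)"
  unfolding net_filter_def directed_set_def
  by (metis (no_types, lifting) eventually_INF1 eventually_principal ex_in_conv mem_Collect_eq)

section \<open>From a bimodule morphism to a contracting element\<close>

lemma bimodule_morphism_vanishes_on_kernel:
  assumes A: "dual_banach_algebra Astar" and \<rho>: "continuous_bimodule_morphism Astar \<rho>"
    and p: "p \<in> Astar" and mult: "\<And>x y. dual_apply p (x * y) = dual_apply p x * dual_apply p y"
    and ker: "{x. dual_apply p x = 0} = closure {a * l | a l. dual_apply p l = 0}"
    and f: "f \<in> Astar" and x: "dual_apply p x = 0"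
  shows "\<rho> x (dual_tensor f p) = 0"
proof -
  define S where "S = sigma_wc_tensor_dual Astar"
  define F where "F = dual_tensor f p"
  \<comment> \<open>Multiples of \<open>F\<close> are again tensors with \<open>p\<close>, since the
    scalar can be absorbed into \<open>f\<close>.\<close>
  have scS: "c *\<^sub>C F \<in> S" for c
    using dual_tensor_sigma_wc[OF A _ p mult, of "c *\<^sub>C f"] A f
    by (simp add: dual_tensor_scaleC S_def F_def dual_banach_algebra_def)
  then have FS: "F \<in> S" by (metis scaleC_one)
  have sd: "\<rho> y \<in> subspace_dual S" for y
    using \<rho> by (simp add: continuous_bimodule_morphism_def S_def Let_def)
  have lin: "clinear (\<lambda>y. \<rho> y F)"
    using \<rho> FS by (simp add: continuous_bimodule_morphism_def S_def Let_def clinear_def scaleC_complex_def)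
  obtain K where K: "\<And>y. subspace_dual_norm S (\<rho> y) \<le> K * norm y"
    using \<rho> unfolding continuous_bimodule_morphism_def S_def Let_def by blast
  have "cmod (\<rho> y F) \<le> (K * norm F) * norm y" for y
    using order_trans[OF subspace_dual_norm_bound[OF sd scS] mult_right_mono[OF K norm_ge_zero]]
    by (simp add: ac_simps)
  with lin have "bounded_clinear (\<lambda>y. \<rho> y F)"
    unfolding bounded_clinear_def by auto
  then have "bounded_linear (\<lambda>y. \<rho> y F)"
    by (rule bounded_clinear_imp_bounded_linear)
  then have cont: "continuous_on UNIV (\<lambda>y. \<rho> y F)"
    by (rule linear_continuous_on)
  have prod: "\<rho> (a * l) F = dual_apply p l * \<rho> a F" for a l
  proof -
    have "\<rho> (a * l) = subspace_dual_ract S (dual_lact ptensor_ract) (\<rho> a) l"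
      using \<rho> unfolding continuous_bimodule_morphism_def S_def Let_def by blast
    then have "\<rho> (a * l) F = \<rho> a (dual_apply p l *\<^sub>C F)"
      using FS by (simp add: subspace_dual_ract_def F_def dual_lact_dual_tensor[OF mult])
    also have "\<dots> = dual_apply p l * \<rho> a F"
      using sd[of a] FS unfolding subspace_dual_def by blast
    finally show ?thesis .
  qed
  \<comment> \<open>A continuous functional that is zero on the products is zero on their
    closure.\<close>
  have "x \<in> closure {a * l | a l. dual_apply p l = 0}"
    using ker x by blast
  then show ?thesis
    unfolding F_def[symmetric]
    by (rule continuous_constant_on_closure[rotated 2]) (auto intro: continuous_on_subset[OF cont] simp: prod)
qed

theorem theorem2p3:
  fixes Astar :: "'a :: complex_banach_algebra cdual set"
    and \<phi> :: "'a \<Rightarrow> complex"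
  assumes "dual_banach_algebra Astar"
    and "approximately_Connes_biprojective TYPE('i) Astar"
    and "\<phi> \<in> wkstar_characters Astar"
    and "{x. \<phi> x = 0} = closure {a * l | a l. \<phi> l = 0}"
  shows "left_contractible \<phi>"
proof -
  note A = assms(1)
  interpret M: banach_bimodule "(*) :: 'a \<Rightarrow> _" "(*)" by (rule banach_bimodule_mult)
  obtain p where p: "p \<in> Astar" and \<phi>: "\<phi> = dual_apply p"
    using wkstar_continuous_in_predual[OF A, of \<phi>] assms(3) by (auto simp: wkstar_characters_def)
  have mult: "dual_apply p (x * y) = dual_apply p x * dual_apply p y" for x y
    using assms(3) by (simp add: wkstar_characters_def \<phi>)
  obtain z where "dual_apply p z \<noteq> 0"
    using assms(3) by (auto simp: wkstar_characters_def \<phi>)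
  then obtain b where b: "dual_apply p b = 1"
    using dual_apply_scaleC[of p "inverse (dual_apply p z)" z] by (metis left_inverse)
  obtain I :: "'i set" and le \<rho> where I: "directed_set I le"
    and \<rho>: "\<And>i. i \<in> I \<Longrightarrow> continuous_bimodule_morphism Astar (\<rho> i)"
    and lim: "\<And>a. ((\<lambda>i. pi_sigma_wc Astar (\<rho> i a)) \<longlongrightarrow> a) (net_filter I le)"
    using assms(2) unfolding approximately_Connes_biprojective_def by blast
  \<comment> \<open>Norm continuity of the character gives the limit \<phi>(b) = 1. One index with a
    nonzero value suffices, and only that morphism is used afterwards.\<close>
  have "((\<lambda>i. dual_apply p (pi_sigma_wc Astar (\<rho> i b))) \<longlongrightarrow> 1) (net_filter I le)"
    using bounded_linear.tendsto[OF bounded_clinear_imp_bounded_linear[OF bounded_clinear_dual_apply] lim, of p b]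
    by (simp add: b)
  then have "eventually (\<lambda>i. dual_apply p (pi_sigma_wc Astar (\<rho> i b)) \<noteq> 0) (net_filter I le)"
    by (rule tendsto_imp_eventually_ne) simp
  with net_filter_index[OF I]
  have "eventually (\<lambda>i. i \<in> I \<and> dual_apply p (pi_sigma_wc Astar (\<rho> i b)) \<noteq> 0) (net_filter I le)"
    by (rule eventually_conj)
  from eventually_happens'[OF net_filter_neq_bot[OF I] this]
  obtain i where i: "i \<in> I" and ne: "dual_apply p (pi_sigma_wc Astar (\<rho> i b)) \<noteq> 0" by blast
  define R where "R = \<rho> i"
  define S where "S = sigma_wc_tensor_dual Astar"
  have R: "continuous_bimodule_morphism Astar R" using \<rho>[OF i] by (simp add: R_def)
  have sd: "R a \<in> subspace_dual S" for a
    using R by (simp add: continuous_bimodule_morphism_def S_def Let_def)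
  have FS: "dual_tensor f p \<in> S" if "f \<in> Astar" for f
    unfolding S_def by (rule dual_tensor_sigma_wc[OF A that p mult])
  have lin: "R (a + c) F = R a F + R c F" "R (k *\<^sub>C a) F = k * R a F" if "F \<in> S" for a c k F
    using R that by (simp_all add: continuous_bimodule_morphism_def S_def Let_def)
  obtain n where n: "\<And>f. f \<in> Astar \<Longrightarrow> dual_apply f n = R b (dual_tensor f p)"
    using dual_tensor_slice[OF A sd FS] by blast
  have "dual_apply p n = dual_apply p (pi_sigma_wc Astar (R b))"
    using n[OF p] dual_apply_pi_sigma_wc[OF A sd[unfolded S_def] p]
    by (simp add: dual_tensor_character[OF mult])
  with ne have pn: "dual_apply p n \<noteq> 0" by (simp add: R_def)
  have an: "a * n = dual_apply p a *\<^sub>C n" for a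
  proof -
    \<comment> \<open>Elements of the algebra that agree on the predual are equal, so the identity
      is tested on each \<open>f\<close>.\<close>
    have "dual_apply f (a * n) = dual_apply f (dual_apply p a *\<^sub>C n)" if f: "f \<in> Astar" for f
    proof -
      have fa: "dual_ract (*) f a \<in> Astar" using A f by (simp add: dual_banach_algebra_def)
      have "dual_apply f (a * n) = R b (dual_tensor (dual_ract (*) f a) p)"
        using n[OF fa] by simp
      also have "\<dots> = R (a * b) (dual_tensor f p)"
      proof -
        \<comment> \<open>Left equivariance turns the right action on the tensor into multiplication
          of the argument of \<open>R\<close> by \<open>a\<close>.\<close>
        have "R (a * b) = subspace_dual_lact S (dual_ract ptensor_lact) a (R b)"
          using R unfolding continuous_bimodule_morphism_def S_def Let_def by blast
        then show ?thesis
          using FS[OF f] by (simp add: subspace_dual_lact_def dual_ract_dual_tensor)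
      qed
      also have "\<dots> = dual_apply p a * R b (dual_tensor f p)"
      proof -
        have "dual_apply p (a * b + (- dual_apply p a) *\<^sub>C b) = 0"
          by (simp add: dual_apply_add dual_apply_scaleC mult b)
        then have "R (a * b + (- dual_apply p a) *\<^sub>C b) (dual_tensor f p) = 0"
          by (rule bimodule_morphism_vanishes_on_kernel[OF A R p mult assms(4)[unfolded \<phi>] f])
        then show ?thesis
          by (simp only: lin[OF FS[OF f]]) simp
      qed
      finally show ?thesis by (simp add: n[OF f] dual_apply_scaleC)
    qed
    moreover have "restrict (\<lambda>f. dual_apply f x) Astar \<in> subspace_dual Astar" for x
      using A by (auto simp: dual_banach_algebra_def bij_betw_def)
    ultimately show ?thesis
      using predual_evaluation[OF A, of "restrict (\<lambda>f. dual_apply f (a * n)) Astar"]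
      by (metis restrict_apply')
  qed
  show ?thesis
    unfolding left_contractible_def \<phi>
  proof (intro exI conjI allI)
    fix a
    \<comment> \<open>The witness is \<open>n\<close> rescaled to have value 1 under the
      character.\<close>
    show "a * (inverse (dual_apply p n) *\<^sub>C n) = dual_apply p a *\<^sub>C inverse (dual_apply p n) *\<^sub>C n"
      by (simp add: mult_scaleC_right an scaleC_scaleC mult.commute)
    show "dual_apply p (inverse (dual_apply p n) *\<^sub>C n) = 1"
      using pn by (simp add: dual_apply_scaleC)
  qed
qed

end
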